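(* Let $N$ be a positive integer, $\Omega=\{-1,+1\}^N$, let $(Y_k)_{k\ge1}$ be the Wolff dynamics on $\Omega$ with coupling constant $\hat J$, started from any initial configuration $Y_1\in\Omega$, with law $\mathbb P$, and let $\mu_N$ be the Gibbs measure of the one-dimensional periodic Ising model with coupling constant $\hat J$. For $x\in\mathbb R^N$ define $g_x(\sigma)=\langle\sigma,x\rangle_{\mathbb R^N}^2$, $\sigma\in\Omega$. For $M\ge1$ let $\mathbb K$ be the $N\times N$ sample covariance matrix $$\mathbb K=\frac1{MN}\sum_{k=1}^MY_kY_k^T.$$ (a) If $\hat J=0$, then for any $x\in\mathbb R^N$ with $\|x\|_2^2=\langle x,x\rangle_{\mathbb R^N}\ne0$, $$E_{\mu_N}[g_x]=\|x\|_2^2,$$ and the largest eigenvalue $\lambda_1(\mathbb K)$ satisfies $$\lim_{M\to+\infty}\lambda_1(\mathbb K)=\frac1N,\qquad\mathbb P\text{-a.s.}$$ (b) If $\hat J=+\infty$, then for any positive integer $N$, $$\lim_{M\to+\infty}\lambda_1(\mathbb K)=1,\qquad\mathbb P\text{-a.s.},$$ and the second largest eigenvalue $\lambda_2(\mathbb K)$ satisfies $$\lim_{M\to+\infty}\lambda_2(\mathbb K)=0,\qquad\mathbb P\text{-a.s.}$$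
   Context: Indices in $[N]=\{1,\dots,N\}$ are cyclic ($N+1\equiv1$). For finite $\hat J$ the Gibbs measure is $\mu_N(\sigma)=Z_N^{-1}\exp\big(\hat J\sum_{i=1}^N\sigma_i\sigma_{i+1}\big)$ on $\Omega$, with $Z_N$ the normalizing constant (so uniform on $\Omega$ when $\hat J=0$); $E_{\mu_N}$ is expectation with respect to $\mu_N$. $\langle\cdot,\cdot\rangle_{\mathbb R^N}$ is the standard inner product. Eigenvalues are counted with multiplicity; the statement on $\lambda_2(\mathbb K)$ is meaningful for $N\ge2$. $G=([N],\mathcal G)$ is the undirected cycle with the $N$ edges $\{i,i+1\}$, $i=1,\dots,N$ (counted with multiplicity if $N=2$). Wolff dynamics: one step from $\sigma\in\Omega$ is as follows. Choose a site $i_0\in[N]$ uniformly at random and start the cluster with $i_0$. Repeatedly, for each site $i$ in the cluster and each edge joining $i$ to a neighbour $j$ with $\sigma_j=\sigma_i$ such that this edge has not been considered before, add $j$ to the cluster with probability $1-e^{-\hat J(1+\sigma_i\sigma_j)}=1-e^{-2\hat J}$ (equal to $1$ when $\hat J=+\infty$ and to $0$ when $\hat J=0$), independently over edges. When no edge remains to be considered, flip all spins of the cluster (with probability 1). Thus for $\hat J=0$ a uniformly chosen single spin is flipped, while for $\hat J=+\infty$ the whole maximal connected set of sites containing $i_0$ on which $\sigma$ is constant is flipped. In the paper $\mathbb K=\frac1M\mathbb X\mathbb X^T$, where $\mathbb X=(X_1,\dots,X_M)$ is the $N\times M$ matrix with columns $X_k=Y_k/\sqrt N$; this is the matrix displayed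 in the claim. *)

theory Defs
  imports
    "HOL-Probability.Probability"
    "Jordan_Normal_Form.Char_Poly"
begin

unbundle no vec_syntax and no inner_syntax

text \<open>Sites are numbered \<open>0, \<dots>, N - 1\<close>. The edge \<open>e < N\<close> of the cycle joins \<open>e\<close> and
  \<open>(e + 1) mod N\<close>; edges are referred to by their number, so that \<open>N = 2\<close> has two parallel edges.\<close>

definition configs :: "nat \<Rightarrow> real vec set" where
  "configs N = {\<sigma> \<in> carrier_vec N. \<forall>i<N. \<sigma> $ i \<in> {-1, 1}}"

definition ising_weight :: "nat \<Rightarrow> real \<Rightarrow> real vec \<Rightarrow> real" where
  "ising_weight N J \<sigma> = exp (J * (\<Sum>i<N. \<sigma> $ i * \<sigma> $ ((i + 1) mod N)))"

definition gibbs :: "nat \<Rightarrow> real \<Rightarrow> real vec measure" where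
  "gibbs N J = point_measure (configs N)
     (\<lambda>\<sigma>. ennreal (ising_weight N J \<sigma> / (\<Sum>\<tau>\<in>configs N. ising_weight N J \<tau>)))"

definition g_fun :: "real vec \<Rightarrow> real vec \<Rightarrow> real" where
  "g_fun x \<sigma> = (\<sigma> \<bullet> x)\<^sup>2"

definition bond_prob :: "ennreal \<Rightarrow> real" where
  "bond_prob J = (if J = \<infinity> then 1 else 1 - exp (- 2 * enn2real J))"

text \<open>Edges still to be considered: \<open>C\<close> is the current cluster, \<open>D\<close> the set of edges already
  considered.\<close>

definition pending :: "nat \<Rightarrow> real vec \<Rightarrow> nat set \<Rightarrow> nat set \<Rightarrow> nat set" where
  "pending N \<sigma> C D = {e \<in> {..<N} - D.
     (e \<in> C \<or> (e + 1) mod N \<in> C) \<and> \<sigma> $ e = \<sigma> $ ((e + 1) mod N)}"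

text \<open>The pending edges are examined in increasing order; as the edges are treated independently
  and each at most once, the law of the final cluster does not depend on this order. One endpoint
  of a pending edge is in \<open>C\<close> already, so inserting both endpoints adds the other one.\<close>

function wolff_cluster ::
  "nat \<Rightarrow> ennreal \<Rightarrow> real vec \<Rightarrow> nat set \<Rightarrow> nat set \<Rightarrow> nat set pmf" where
  "wolff_cluster N J \<sigma> C D =
     (if pending N \<sigma> C D = {} then return_pmf C
      else let e = Min (pending N \<sigma> C D) in
        bind_pmf (bernoulli_pmf (bond_prob J)) (\<lambda>b.
          wolff_cluster N J \<sigma> (if b then C \<union> {e, (e + 1) mod N} else C) (insert e D)))"
  by pat_completeness auto
termination
proof (relation "Wellfounded.measure (\<lambda>(N, J, \<sigma>, C, D). card ({..<N} - D))", goal_cases)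
  case (2 N J \<sigma> C D e b)
  have "finite (pending N \<sigma> C D)"
    by (simp add: pending_def)
  with 2 have "e \<in> pending N \<sigma> C D"
    using Min_in by blast
  then have "e \<in> {..<N} - D"
    by (simp add: pending_def)
  then have "{..<N} - insert e D \<subset> {..<N} - D"
    by auto
  then show ?case
    by (simp add: psubset_card_mono)
qed simp

declare wolff_cluster.simps [simp del]

definition flip_spins :: "nat set \<Rightarrow> real vec \<Rightarrow> real vec" where
  "flip_spins C \<sigma> = vec (dim_vec \<sigma>) (\<lambda>i. if i \<in> C then - \<sigma> $ i else \<sigma> $ i)"

definition wolff_step :: "nat \<Rightarrow> ennreal \<Rightarrow> real vec \<Rightarrow> real vec pmf" where
  "wolff_step N J \<sigma> =
     bind_pmf (pmf_of_set {..<N}) (\<lambda>i0.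
       map_pmf (\<lambda>C. flip_spins C \<sigma>) (wolff_cluster N J \<sigma> {i0} {}))"

text \<open>\<open>(Y k)\<close>, \<open>k \<ge> 1\<close>, is a Markov chain on \<open>P\<close> with transition kernel \<open>wolff_step N J\<close> and
  initial configuration \<open>y\<close>; \<open>Y 0\<close> is irrelevant.\<close>

definition wolff_dynamics ::
  "nat \<Rightarrow> ennreal \<Rightarrow> real vec \<Rightarrow> 'w measure \<Rightarrow> (nat \<Rightarrow> 'w \<Rightarrow> real vec) \<Rightarrow> bool" where
  "wolff_dynamics N J y P Y \<longleftrightarrow>
     prob_space P \<and>
     (\<forall>k\<ge>1. Y k \<in> measurable P (count_space (configs N))) \<and>
     (AE \<omega> in P. Y 1 \<omega> = y) \<and>
     (\<forall>n\<ge>1. \<forall>s. \<P>(\<omega> in P. \<forall>k\<in>{1..n}. Y k \<omega> = s k) \<noteq> 0 \<longrightarrow>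
        \<P>(\<omega> in P. Y (n + 1) \<omega> = s (n + 1) \<bar> \<forall>k\<in>{1..n}. Y k \<omega> = s k)
          = pmf (wolff_step N J (s n)) (s (n + 1)))"

definition sample_cov :: "nat \<Rightarrow> nat \<Rightarrow> (nat \<Rightarrow> real vec) \<Rightarrow> real mat" where
  "sample_cov N M y =
     mat N N (\<lambda>(i, j). 1 / (real M * real N) * (\<Sum>k=1..M. y k $ i * y k $ j))"

text \<open>The \<open>k\<close>-th largest real eigenvalue (\<open>k \<ge> 1\<close>), counted with multiplicity. For a symmetric
  \<open>N \<times> N\<close> matrix the characteristic polynomial has \<open>N\<close> real roots, so this is meaningful for
  \<open>1 \<le> k \<le> N\<close>.\<close>

definition eigval :: "nat \<Rightarrow> real mat \<Rightarrow> real" where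
  "eigval k A = rev (sorted_list_of_multiset (proots (char_poly A))) ! (k - 1)"

end

theory Submission
  imports Defs "Jordan_Normal_Form.Schur_Decomposition" "HOL-Library.Discrete_Functions"
begin

text \<open>Everything about the eigenvalues is read off from two traces. A real symmetric matrix has
  real eigenvalues, their sum is the trace, and the sum of their squares is the sum of the squares
  of all entries (\<open>symmetric_eigval\<close>). Since spins have square \<open>1\<close>, the diagonal of \<open>\<K>\<close> is constantly
  \<open>1 / N\<close>, so both claims reduce to the a.s. limits of the time averages of the spin products
  \<open>Y\<^sub>k(i) Y\<^sub>k(j)\<close> for \<open>i \<noteq> j\<close>:

  If all of them tend to \<open>0\<close>, then \<open>(\<lambda>\<^sub>1 - 1/N)\<^sup>2\<close> is at most the trace of \<open>(\<K> - I/N)\<^sup>2\<close>, that is, the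
  sum of the squared off-diagonal entries, which tends to \<open>0\<close>. If all of them tend to \<open>1\<close>, then
  the sum of all squared entries tends to \<open>1\<close>. Since \<open>\<K>\<close> is positive semidefinite of trace \<open>1\<close>, this
  sum is at most \<open>\<lambda>\<^sub>1 \<le> 1\<close>, and \<open>0 \<le> \<lambda>\<^sub>2 \<le> 1 - \<lambda>\<^sub>1\<close>.

  At zero coupling one step flips a single uniformly chosen spin. The product of the spins at
  \<open>i \<noteq> j\<close> changes sign exactly when \<open>i\<close> or \<open>j\<close> is chosen, so it is an eigenfunction of the
  transition kernel for the eigenvalue \<open>1 - 4/N \<noteq> 1\<close> (\<open>spin_product_eigenfunction\<close>). For any
  finite Markov chain the time averages of such an eigenfunction tend to \<open>0\<close> almost surely
  (\<open>time_average_eigenfunction\<close>): up to a bounded error and a constant factor they are the averages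
  of a martingale with bounded increments. Only the averages
  converge, not the law: the chain is periodic, since every step changes the parity of the number
  of plus spins.

  At infinite coupling one step from a nonconstant configuration flips a maximal constant arc,
  after which the two edges bounding it join equal spins and no other edge has changed its type.
  So the number of edges joining different spins decreases strictly until the configuration is
  constant (\<open>wolff_step_infinity_walls\<close>); constant configurations stay constant, with all spin
  products equal to \<open>1\<close>.

  The Gibbs measure at zero coupling is uniform, under which distinct spins are orthogonal by
  symmetry under the flip of one of them; expanding the square in \<open>g\<^sub>x\<close> gives its mean.\<close>

section \<open>Eigenvalues of real symmetric matrices\<close>

definition mat_trace :: "real mat \<Rightarrow> real" where
  "mat_trace A = (\<Sum>i<dim_row A. A $$ (i, i))"

lemma index_mult_mat_sum:
  assumes "A \<in> carrier_mat n n" "B \<in> carrier_mat n n" "i < n" "j < n"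
  shows "(A * B) $$ (i, j) = (\<Sum>k<n. A $$ (i, k) * B $$ (k, j))"
  using assms by (auto simp: scalar_prod_def atLeast0LessThan intro!: sum.cong)

lemma mat_trace_mult_commute:
  assumes A: "A \<in> carrier_mat n n" and B: "B \<in> carrier_mat n n"
  shows "mat_trace (A * B) = mat_trace (B * A)"
proof -
  have "mat_trace (A * B) = (\<Sum>i<n. \<Sum>k<n. A $$ (i, k) * B $$ (k, i))"
    using A by (simp add: mat_trace_def index_mult_mat_sum[OF A B] del: index_mult_mat(1))
  also have "\<dots> = (\<Sum>k<n. \<Sum>i<n. B $$ (k, i) * A $$ (i, k))"
    by (subst sum.swap) (simp add: mult.commute)
  also have "\<dots> = mat_trace (B * A)"
    using B by (simp add: mat_trace_def index_mult_mat_sum[OF B A] del: index_mult_mat(1))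
  finally show ?thesis .
qed

text \<open>If \<open>A = P B Q\<close> with \<open>Q P = 1\<close>, then \<open>A\<^sup>2 = P B\<^sup>2 Q\<close>; under the trace, \<open>P\<close> can be moved cyclically
  behind \<open>Q\<close>, where the two cancel.\<close>

lemma mat_trace_similar:
  assumes A: "A \<in> carrier_mat n n" and sim: "similar_mat_wit A B P Q"
  shows "mat_trace A = mat_trace B" "mat_trace (A * A) = mat_trace (B * B)"
proof -
  note w = similar_mat_witD2[OF A sim]
  have *: "mat_trace (P * C * Q) = mat_trace C" if C: "C \<in> carrier_mat n n" for C
  proof -
    have "mat_trace (P * C * Q) = mat_trace (Q * (P * C))"
      using w C by (intro mat_trace_mult_commute) auto
    also have "Q * (P * C) = (Q * P) * C"
      using w C by (subst assoc_mult_mat[of Q n n P n C n]) auto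
    also have "\<dots> = C" using w C by simp
    finally show ?thesis .
  qed
  show "mat_trace A = mat_trace B" using *[OF w(5)] w(3) by simp
  have "A * A = (P * B * Q) * (P * B * Q)" using w(3) by simp
  also have "\<dots> = P * B * (Q * (P * B * Q))"
    using w by (intro assoc_mult_mat[of _ n n _ n _ n]) auto
  also have "Q * (P * B * Q) = Q * P * (B * Q)"
    using w assoc_mult_mat[of P n n B n Q n] assoc_mult_mat[of Q n n P n "B * Q" n] by auto
  also have "\<dots> = B * Q" using w by simp
  also have "P * B * (B * Q) = P * (B * B) * Q"
    using w assoc_mult_mat[of P n n B n "B * Q" n] assoc_mult_mat[of B n n B n Q n]
      assoc_mult_mat[of P n n "B * B" n Q n] by auto
  finally show "mat_trace (A * A) = mat_trace (B * B)" using *[of "B * B"] w by simp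
qed

lemma mat_trace_square_upper_triangular:
  assumes B: "B \<in> carrier_mat n n" and ut: "upper_triangular B"
  shows "mat_trace (B * B) = (\<Sum>i<n. (B $$ (i, i))\<^sup>2)"
proof -
  have "(B * B) $$ (i, i) = (B $$ (i, i))\<^sup>2" if i: "i < n" for i
  proof -
    \<comment> \<open>For \<open>k \<noteq> i\<close>, one of the two factors lies below the diagonal.\<close>
    have "(B * B) $$ (i, i) = (\<Sum>k<n. B $$ (i, k) * B $$ (k, i))"
      by (rule index_mult_mat_sum[OF B B i i])
    also have "\<dots> = (\<Sum>k<n. if k = i then (B $$ (i, i))\<^sup>2 else 0)"
    proof (rule sum.cong)
      fix k assume k: "k \<in> {..<n}"
      have "B $$ (i, k) = 0 \<or> B $$ (k, i) = 0" if "k \<noteq> i"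
        using that k i B upper_triangularD[OF ut, of k i] upper_triangularD[OF ut, of i k]
        by (cases "k < i") auto
      then show "B $$ (i, k) * B $$ (k, i) = (if k = i then (B $$ (i, i))\<^sup>2 else 0)"
        by (auto simp: power2_eq_square)
    qed simp
    also have "\<dots> = (B $$ (i, i))\<^sup>2" using i by simp
    finally show ?thesis .
  qed
  then show ?thesis using B by (simp add: mat_trace_def del: index_mult_mat(1))
qed

text \<open>With an eigenvector \<open>v\<close>, the number \<open>q = \<Sum>\<^sub>i\<^sub>j A\<^sub>i\<^sub>j v\<^sub>j cnj v\<^sub>i\<close> equals the eigenvalue times
  \<open>\<Sum>\<^sub>i |v\<^sub>i|\<^sup>2\<close>, and by symmetry of \<open>A\<close> it is its own conjugate.\<close>

lemma symmetric_eigenvalue_real: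
  fixes A :: "real mat"
  assumes A: "A \<in> carrier_mat n n"
    and sym: "\<And>i j. i < n \<Longrightarrow> j < n \<Longrightarrow> A $$ (i, j) = A $$ (j, i)"
    and ev: "eigenvalue (map_mat complex_of_real A) c"
  shows "c \<in> \<real>"
proof -
  let ?A = "map_mat complex_of_real A"
  obtain v where v: "v \<in> carrier_vec n" "v \<noteq> 0\<^sub>v n" and Av: "?A *\<^sub>v v = c \<cdot>\<^sub>v v"
    using ev A unfolding eigenvalue_def eigenvector_def by auto
  define q where "q = (\<Sum>i<n. \<Sum>j<n. of_real (A $$ (i, j)) * (v $ j * cnj (v $ i)))"
  define s where "s = (\<Sum>i<n. (cmod (v $ i))\<^sup>2)"
  have row: "(\<Sum>j<n. of_real (A $$ (i, j)) * v $ j) = c * v $ i" if "i < n" for i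
  proof -
    have "(?A *\<^sub>v v) $ i = (\<Sum>j<n. of_real (A $$ (i, j)) * v $ j)"
      using that A v by (auto simp: scalar_prod_def atLeast0LessThan intro!: sum.cong)
    then show ?thesis using Av that v by simp
  qed
  have "q = (\<Sum>i<n. (\<Sum>j<n. of_real (A $$ (i, j)) * v $ j) * cnj (v $ i))"
    by (simp add: q_def sum_distrib_right mult.assoc)
  also have "\<dots> = c * of_real s"
    by (simp add: row s_def sum_distrib_left complex_norm_square mult.assoc
        of_real_power[symmetric] del: of_real_power)
  finally have q: "q = c * of_real s" .
  have "cnj q = (\<Sum>i<n. \<Sum>j<n. of_real (A $$ (j, i)) * (v $ i * cnj (v $ j)))"
    using sym by (auto simp: q_def mult.commute intro!: sum.cong)
  also have "\<dots> = q"
    unfolding q_def by (rule sum.swap)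
  finally have "q \<in> \<real>" by (simp add: Reals_cnj_iff)
  moreover have "s \<noteq> 0"
  proof
    assume "s = 0"
    then have "\<forall>i<n. v $ i = 0" by (simp add: s_def sum_nonneg_eq_0_iff)
    then have "v = 0\<^sub>v n" using v(1) by (intro eq_vecI) auto
    with v(2) show False by simp
  qed
  ultimately have "c * of_real s / of_real s \<in> \<real>" unfolding q[symmetric] by (intro Reals_divide) auto
  with \<open>s \<noteq> 0\<close> show ?thesis by simp
qed

text \<open>The characteristic polynomial splits over the complex numbers, and all roots are real, so it
  splits over the reals and the Schur decomposition yields a real upper triangular matrix with the
  roots on its diagonal. The traces of this matrix and of its square are the first two power sums
  of the roots. By symmetry the trace of \<open>A\<^sup>2\<close> is the sum of the squared entries of \<open>A\<close>.\<close>

lemma symmetric_eigenvalues: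
  fixes A :: "real mat"
  assumes A: "A \<in> carrier_mat n n"
    and sym: "\<And>i j. i < n \<Longrightarrow> j < n \<Longrightarrow> A $$ (i, j) = A $$ (j, i)"
  obtains es where "char_poly A = (\<Prod>e\<leftarrow>es. [:- e, 1:])" "length es = n"
    "sum_list es = (\<Sum>i<n. A $$ (i, i))"
    "(\<Sum>e\<leftarrow>es. e\<^sup>2) = (\<Sum>i<n. \<Sum>j<n. (A $$ (i, j))\<^sup>2)"
proof -
  let ?A = "map_mat complex_of_real A"
  have cA: "?A \<in> carrier_mat n n" using A by simp
  obtain cs where cs: "char_poly ?A = (\<Prod>c\<leftarrow>cs. [:- c, 1:])" "length cs = n"
    using char_poly_factorized[OF cA] by blast
  have real: "c \<in> \<real>" if "c \<in> set cs" for c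
  proof (rule symmetric_eigenvalue_real[OF A sym])
    have "poly (\<Prod>c\<leftarrow>cs. [:- c, 1:]) c = 0"
      using that by (induction cs) auto
    then show "eigenvalue ?A c"
      using eigenvalue_root_char_poly[OF cA] cs(1) by simp
  qed auto
  define es where "es = map Re cs"
  have cs_es: "cs = map complex_of_real es"
    using real by (auto simp: es_def o_def intro!: map_idI[symmetric] elim: Reals_cases)
  interpret mp: map_poly_inj_idom_hom complex_of_real ..
  have "map_poly complex_of_real (char_poly A) = char_poly ?A"
    by (rule of_real_hom.char_poly_hom[OF A, symmetric])
  also have "\<dots> = map_poly complex_of_real (\<Prod>e\<leftarrow>es. [:- e, 1:])"
    unfolding cs(1) cs_es mp.hom_prod_list by (simp add: o_def)
  finally have cp: "char_poly A = (\<Prod>e\<leftarrow>es. [:- e, 1:])"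
    by simp
  obtain B P Q where "schur_decomposition A es = (B, P, Q)" by (metis prod_cases3)
  from schur_decomposition[OF A cp this]
  have sim: "similar_mat_wit A B P Q" and ut: "upper_triangular B" and diag: "diag_mat B = es"
    by auto
  have B: "B \<in> carrier_mat n n" using similar_mat_witD2[OF A sim] by auto
  have len: "length es = n" using cs by (simp add: es_def)
  have es: "es = map (\<lambda>i. B $$ (i, i)) [0..<n]"
    using diag B by (simp add: diag_mat_def)
  show thesis
  proof
    have "sum_list es = mat_trace B"
      using B unfolding es by (simp add: mat_trace_def sum_list_sum_nth atLeast0LessThan)
    also have "\<dots> = mat_trace A" using mat_trace_similar[OF A sim] by simp
    finally show "sum_list es = (\<Sum>i<n. A $$ (i, i))" using A by (simp add: mat_trace_def)
    have "(\<Sum>e\<leftarrow>es. e\<^sup>2) = mat_trace (B * B)"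
      unfolding mat_trace_square_upper_triangular[OF B ut]
      unfolding es by (simp add: sum_list_sum_nth atLeast0LessThan)
    also have "\<dots> = mat_trace (A * A)" using mat_trace_similar[OF A sim] by simp
    also have "\<dots> = (\<Sum>i<n. \<Sum>j<n. (A $$ (i, j))\<^sup>2)"
      using A sym by (auto simp: mat_trace_def index_mult_mat_sum[OF A A] power2_eq_square
          simp del: index_mult_mat(1) intro!: sum.cong)
    finally show "(\<Sum>e\<leftarrow>es. e\<^sup>2) = (\<Sum>i<n. \<Sum>j<n. (A $$ (i, j))\<^sup>2)" .
  qed (use cp len in auto)
qed

lemma proots_linear_factors: "proots (\<Prod>e\<leftarrow>es. [:- e, 1:]) = mset (es :: real list)"
proof (induction es)
  case (Cons e es)
  have "(\<Prod>e\<leftarrow>es. [:- e, 1:]) \<noteq> 0" by (auto simp: prod_list_zero_iff)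
  with Cons show ?case by (simp add: proots_mult del: mult_pCons_left)
qed simp

text \<open>The list of eigenvalues is sorted decreasingly here because \<^const>\<open>eigval\<close> enumerates them in
  this order.\<close>

lemma symmetric_eigval:
  fixes A :: "real mat"
  assumes A: "A \<in> carrier_mat n n"
    and sym: "\<And>i j. i < n \<Longrightarrow> j < n \<Longrightarrow> A $$ (i, j) = A $$ (j, i)"
  obtains es where "\<And>k. eigval k A = es ! (k - 1)" "sorted_wrt (\<ge>) es" "length es = n"
    "sum_list es = (\<Sum>i<n. A $$ (i, i))"
    "(\<Sum>e\<leftarrow>es. e\<^sup>2) = (\<Sum>i<n. \<Sum>j<n. (A $$ (i, j))\<^sup>2)"
    "\<And>e. e \<in> set es \<Longrightarrow> eigenvalue A e"
proof -
  obtain ds where ds: "char_poly A = (\<Prod>e\<leftarrow>ds. [:- e, 1:])" "length ds = n"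
    "sum_list ds = (\<Sum>i<n. A $$ (i, i))"
    "(\<Sum>e\<leftarrow>ds. e\<^sup>2) = (\<Sum>i<n. \<Sum>j<n. (A $$ (i, j))\<^sup>2)"
    using symmetric_eigenvalues[OF A sym] by blast
  define es where "es = rev (sort ds)"
  have m: "mset es = mset ds" by (simp add: es_def)
  show thesis
  proof
    show "eigval k A = es ! (k - 1)" for k
      by (simp add: eigval_def ds(1) proots_linear_factors es_def sorted_list_of_multiset_mset)
    show "sorted_wrt (\<ge>) es" by (simp add: es_def sorted_wrt_rev)
    show "length es = n" using ds(2) by (simp add: es_def)
    show "sum_list es = (\<Sum>i<n. A $$ (i, i))"
      using ds(3) by (metis m sum_mset_sum_list)
    show "(\<Sum>e\<leftarrow>es. e\<^sup>2) = (\<Sum>i<n. \<Sum>j<n. (A $$ (i, j))\<^sup>2)"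
      using ds(4) by (metis m mset_map sum_mset_sum_list)
    show "eigenvalue A e" if "e \<in> set es" for e
    proof -
      have "e \<in> set ds" using that by (simp add: es_def)
      then have "poly (\<Prod>c\<leftarrow>ds. [:- c, 1:]) e = 0" by (induction ds) auto
      then show ?thesis using eigenvalue_root_char_poly[OF A] ds(1) by simp
    qed
  qed
qed

text \<open>The numbers \<open>(e - c)\<^sup>2\<close>, over all eigenvalues \<open>e\<close>, add up to the trace of \<open>(A - c I)\<^sup>2\<close>, in which
  only the off-diagonal entries survive; the largest eigenvalue contributes one of these
  nonnegative terms.\<close>

lemma eigval_1_near_scalar_matrix:
  fixes A :: "real mat"
  assumes A: "A \<in> carrier_mat n n" and "n \<ge> 1"
    and sym: "\<And>i j. i < n \<Longrightarrow> j < n \<Longrightarrow> A $$ (i, j) = A $$ (j, i)"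
    and diag: "\<And>i. i < n \<Longrightarrow> A $$ (i, i) = c"
  shows "(eigval 1 A - c)\<^sup>2 \<le> (\<Sum>i<n. \<Sum>j\<in>{..<n} - {i}. (A $$ (i, j))\<^sup>2)"
proof -
  obtain es where es: "\<And>k. eigval k A = es ! (k - 1)" "length es = n"
    "sum_list es = (\<Sum>i<n. A $$ (i, i))"
    "(\<Sum>e\<leftarrow>es. e\<^sup>2) = (\<Sum>i<n. \<Sum>j<n. (A $$ (i, j))\<^sup>2)"
    using symmetric_eigval[OF A sym] by blast
  have "(eigval 1 A - c)\<^sup>2 \<in> set (map (\<lambda>e. (e - c)\<^sup>2) es)"
    using es(1)[of 1] es(2) \<open>n \<ge> 1\<close> by auto
  then have "(eigval 1 A - c)\<^sup>2 \<le> (\<Sum>e\<leftarrow>es. (e - c)\<^sup>2)"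
    by (intro member_le_sum_list) auto
  also have "\<dots> = (\<Sum>e\<leftarrow>es. e\<^sup>2) - 2 * c * sum_list es + real (length es) * c\<^sup>2"
    by (induction es) (auto simp: algebra_simps power2_eq_square)
  also have "\<dots> = (\<Sum>i<n. (\<Sum>j<n. (A $$ (i, j))\<^sup>2) - c\<^sup>2)"
    unfolding es(2-4) by (simp add: diag sum_subtractf) (simp add: power2_eq_square)
  also have "\<dots> = (\<Sum>i<n. \<Sum>j\<in>{..<n} - {i}. (A $$ (i, j))\<^sup>2)"
    by (intro sum.cong refl) (simp add: sum_diff1 diag)
  finally show ?thesis .
qed

text \<open>For nonnegative numbers \<open>e \<le> d\<close> one has \<open>e\<^sup>2 \<le> d e\<close>; summing over all eigenvalues \<open>e\<close>, with \<open>d\<close> the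
  largest of them, bounds the sum of their squares by \<open>d\<close> times the trace, which is \<open>1\<close>. The
  eigenvalues other than the largest share the remaining trace \<open>1 - d\<close>.\<close>

lemma eigval_psd_trace_1:
  fixes A :: "real mat"
  assumes A: "A \<in> carrier_mat n n" and "n \<ge> 1"
    and sym: "\<And>i j. i < n \<Longrightarrow> j < n \<Longrightarrow> A $$ (i, j) = A $$ (j, i)"
    and psd: "\<And>e. eigenvalue A e \<Longrightarrow> 0 \<le> e"
    and tr: "(\<Sum>i<n. A $$ (i, i)) = 1"
  shows "(\<Sum>i<n. \<Sum>j<n. (A $$ (i, j))\<^sup>2) \<le> eigval 1 A" "eigval 1 A \<le> 1"
    "n \<ge> 2 \<Longrightarrow> 0 \<le> eigval 2 A" "n \<ge> 2 \<Longrightarrow> eigval 2 A \<le> 1 - eigval 1 A"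
proof -
  obtain es where es: "\<And>k. eigval k A = es ! (k - 1)" "sorted_wrt (\<ge>) es" "length es = n"
    "sum_list es = (\<Sum>i<n. A $$ (i, i))"
    "(\<Sum>e\<leftarrow>es. e\<^sup>2) = (\<Sum>i<n. \<Sum>j<n. (A $$ (i, j))\<^sup>2)"
    "\<And>e. e \<in> set es \<Longrightarrow> eigenvalue A e"
    using symmetric_eigval[OF A sym] by blast
  obtain d ds where d: "es = d # ds" using es(3) \<open>n \<ge> 1\<close> by (cases es) auto
  have nonneg: "0 \<le> e" if "e \<in> set es" for e using psd es(6) that by blast
  have d1: "d + sum_list ds = 1" using es(4) tr d by simp
  have eig1: "eigval 1 A = d" using es(1)[of 1] d by simp
  have "(\<Sum>e\<leftarrow>es. e\<^sup>2) \<le> (\<Sum>e\<leftarrow>es. d * e)"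
  proof (rule sum_list_mono)
    fix e assume "e \<in> set es"
    then have "e \<le> d" "0 \<le> e" using es(2) nonneg unfolding d by auto
    then show "e\<^sup>2 \<le> d * e" by (simp add: power2_eq_square mult_right_mono)
  qed
  also have "\<dots> = d" using d1 d by (simp add: sum_list_const_mult distrib_left[symmetric])
  finally show "(\<Sum>i<n. \<Sum>j<n. (A $$ (i, j))\<^sup>2) \<le> eigval 1 A" using es(5) eig1 by simp
  have "sum_list ds \<ge> 0" using nonneg d by (intro sum_list_nonneg) auto
  then show "eigval 1 A \<le> 1" using d1 eig1 by simp
  assume "n \<ge> 2"
  then obtain b bs where b: "ds = b # bs" using es(3) d by (cases ds) auto
  have eig2: "eigval 2 A = b" using es(1)[of 2] d b by simp
  show "0 \<le> eigval 2 A" using nonneg[of b] d b eig2 by simp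
  have "sum_list bs \<ge> 0" using nonneg d b by (intro sum_list_nonneg) auto
  then show "eigval 2 A \<le> 1 - eigval 1 A" using d1 eig1 eig2 b by simp
qed

section \<open>Eigenvalues of the sample covariance matrix\<close>

lemma spin_square: "\<sigma> \<in> configs N \<Longrightarrow> i < N \<Longrightarrow> \<sigma> $ i * \<sigma> $ i = 1"
  by (auto simp: configs_def)

lemma sample_cov_carrier: "sample_cov N M y \<in> carrier_mat N N"
  by (simp add: sample_cov_def)

lemma sample_cov_sym:
  "i < N \<Longrightarrow> j < N \<Longrightarrow> sample_cov N M y $$ (i, j) = sample_cov N M y $$ (j, i)"
  by (simp add: sample_cov_def mult.commute)

lemma sample_cov_diag:
  assumes "M \<ge> 1" "i < N" "\<And>k. k \<ge> 1 \<Longrightarrow> y k \<in> configs N"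
  shows "sample_cov N M y $$ (i, i) = 1 / real N"
proof -
  have "(\<Sum>k=1..M. y k $ i * y k $ i) = (\<Sum>k=1..M. 1)"
    using assms by (intro sum.cong refl spin_square) auto
  then show ?thesis using assms by (simp add: sample_cov_def)
qed

text \<open>The quadratic form of the sample covariance matrix is a nonnegative multiple of
  \<open>\<Sum>\<^sub>k \<langle>y\<^sub>k, v\<rangle>\<^sup>2\<close>.\<close>

lemma sample_cov_eigenvalue_nonneg:
  assumes y: "\<And>k. k \<ge> 1 \<Longrightarrow> y k \<in> configs N" and ev: "eigenvalue (sample_cov N M y) e"
  shows "0 \<le> e"
proof -
  let ?A = "sample_cov N M y" and ?c = "1 / (real M * real N)"
  obtain v where v: "v \<in> carrier_vec N" "v \<noteq> 0\<^sub>v N" and Av: "?A *\<^sub>v v = e \<cdot>\<^sub>v v"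
    using ev sample_cov_carrier[of N M y] unfolding eigenvalue_def eigenvector_def by auto
  have row: "(\<Sum>j<N. ?A $$ (i, j) * v $ j) = e * v $ i" if "i < N" for i
  proof -
    have "(?A *\<^sub>v v) $ i = (\<Sum>j<N. ?A $$ (i, j) * v $ j)"
      using that sample_cov_carrier[of N M y] v
      by (auto simp: scalar_prod_def atLeast0LessThan intro!: sum.cong)
    then show ?thesis using Av that v by simp
  qed
  have "e * (\<Sum>i<N. (v $ i)\<^sup>2) = (\<Sum>i<N. \<Sum>j<N. ?A $$ (i, j) * v $ j * v $ i)"
    unfolding sum_distrib_right[symmetric]
    by (simp add: row sum_distrib_left power2_eq_square mult.assoc)
  also have "\<dots> = (\<Sum>i<N. \<Sum>j<N. \<Sum>k=1..M. ?c * ((y k $ i * v $ i) * (y k $ j * v $ j)))"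
    by (intro sum.cong refl) (simp add: sample_cov_def sum_distrib_left sum_distrib_right mult_ac)
  also have "\<dots> = (\<Sum>i<N. \<Sum>k=1..M. \<Sum>j<N. ?c * ((y k $ i * v $ i) * (y k $ j * v $ j)))"
    by (intro sum.cong refl sum.swap)
  also have "\<dots> = (\<Sum>k=1..M. \<Sum>i<N. \<Sum>j<N. ?c * ((y k $ i * v $ i) * (y k $ j * v $ j)))"
    by (rule sum.swap)
  also have "\<dots> = (\<Sum>k=1..M. ?c * (\<Sum>i<N. y k $ i * v $ i)\<^sup>2)"
    by (simp only: power2_eq_square sum_product) (simp only: sum_distrib_left)
  also have "\<dots> \<ge> 0" by (intro sum_nonneg mult_nonneg_nonneg) auto
  finally have "0 \<le> e * (\<Sum>i<N. (v $ i)\<^sup>2)" .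
  moreover have "(\<Sum>i<N. (v $ i)\<^sup>2) > 0"
  proof (rule ccontr)
    assume "\<not> ?thesis"
    then have "(\<Sum>i<N. (v $ i)\<^sup>2) = 0"
      using sum_nonneg[of "{..<N}" "\<lambda>i. (v $ i)\<^sup>2"] by force
    then have "\<forall>i<N. v $ i = 0" by (simp add: sum_nonneg_eq_0_iff)
    then have "v = 0\<^sub>v N" using v(1) by (intro eq_vecI) auto
    with v(2) show False by simp
  qed
  ultimately show ?thesis by (simp add: zero_le_mult_iff)
qed

lemma eigval_1_limit_uncorrelated:
  assumes N: "N \<ge> 1" and y: "\<And>k. k \<ge> 1 \<Longrightarrow> y k \<in> configs N"
    and lim: "\<And>i j. i < N \<Longrightarrow> j < N \<Longrightarrow> i \<noteq> j \<Longrightarrow>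
      (\<lambda>M. (\<Sum>k=1..M. y k $ i * y k $ j) / real M) \<longlonglongrightarrow> 0"
  shows "(\<lambda>M. eigval 1 (sample_cov N M y)) \<longlonglongrightarrow> 1 / real N"
proof -
  let ?K = "\<lambda>M. sample_cov N M y"
  have entry: "(\<lambda>M. ?K M $$ (i, j)) \<longlonglongrightarrow> 0" if "i < N" "j < N" "i \<noteq> j" for i j
    using tendsto_divide[OF lim[OF that] tendsto_const[of "real N"]] that
    by (simp add: sample_cov_def mult.commute field_simps)
  have "(\<lambda>M. (\<Sum>i<N. \<Sum>j\<in>{..<N} - {i}. (?K M $$ (i, j))\<^sup>2))
      \<longlonglongrightarrow> (\<Sum>i<N. \<Sum>j\<in>{..<N} - {i}. 0\<^sup>2)"
    by (intro tendsto_sum tendsto_power entry) auto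
  then have "(\<lambda>M. (\<Sum>i<N. \<Sum>j\<in>{..<N} - {i}. (?K M $$ (i, j))\<^sup>2)) \<longlonglongrightarrow> 0"
    by simp
  then have "(\<lambda>M. (eigval 1 (?K M) - 1 / real N)\<^sup>2) \<longlonglongrightarrow> 0"
  proof (rule tendsto_sandwich[OF _ _ tendsto_const, rotated 2])
    show "\<forall>\<^sub>F M in sequentially. (eigval 1 (?K M) - 1 / real N)\<^sup>2
        \<le> (\<Sum>i<N. \<Sum>j\<in>{..<N} - {i}. (?K M $$ (i, j))\<^sup>2)"
      using eventually_ge_at_top[of 1]
      by eventually_elim (intro eigval_1_near_scalar_matrix sample_cov_carrier sample_cov_sym
          sample_cov_diag y N)
  qed simp
  then have "(\<lambda>M. eigval 1 (?K M) - 1 / real N) \<longlonglongrightarrow> 0"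
    by (simp add: power_tendsto_0_iff)
  then show ?thesis by (simp add: LIM_zero_iff)
qed

text \<open>In the limit the \<open>N\<^sup>2\<close> entries are all \<open>1 / N\<close>, so their squares add up to \<open>1\<close>, which squeezes
  the largest eigenvalue to \<open>1\<close> and leaves nothing of the trace for the second.\<close>

lemma eigval_limit_fully_correlated:
  assumes N: "N \<ge> 1" and y: "\<And>k. k \<ge> 1 \<Longrightarrow> y k \<in> configs N"
    and lim: "\<And>i j. i < N \<Longrightarrow> j < N \<Longrightarrow> (\<lambda>M. (\<Sum>k=1..M. y k $ i * y k $ j) / real M) \<longlonglongrightarrow> 1"
  shows "(\<lambda>M. eigval 1 (sample_cov N M y)) \<longlonglongrightarrow> 1"
    and "N \<ge> 2 \<Longrightarrow> (\<lambda>M. eigval 2 (sample_cov N M y)) \<longlonglongrightarrow> 0"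
proof -
  let ?K = "\<lambda>M. sample_cov N M y"
  have entry: "(\<lambda>M. ?K M $$ (i, j)) \<longlonglongrightarrow> 1 / real N" if "i < N" "j < N" for i j
    using tendsto_divide[OF lim[OF that] tendsto_const[of "real N"]] that
    by (simp add: sample_cov_def mult.commute field_simps)
  have "(\<lambda>M. (\<Sum>i<N. \<Sum>j<N. (?K M $$ (i, j))\<^sup>2)) \<longlonglongrightarrow> (\<Sum>i<N. \<Sum>j<N. (1 / real N)\<^sup>2)"
    by (intro tendsto_sum tendsto_power entry) auto
  also have "(\<Sum>i<N. \<Sum>j<N. (1 / real N)\<^sup>2) = 1"
    using N by (simp add: power2_eq_square)
  finally have sq: "(\<lambda>M. (\<Sum>i<N. \<Sum>j<N. (?K M $$ (i, j))\<^sup>2)) \<longlonglongrightarrow> 1" .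
  have trace: "(\<Sum>i<N. ?K M $$ (i, i)) = 1" if "M \<ge> 1" for M
    using N that by (simp add: sample_cov_diag y)
  have bounds: "(\<Sum>i<N. \<Sum>j<N. (?K M $$ (i, j))\<^sup>2) \<le> eigval 1 (?K M)" "eigval 1 (?K M) \<le> 1"
    "N \<ge> 2 \<Longrightarrow> 0 \<le> eigval 2 (?K M)" "N \<ge> 2 \<Longrightarrow> eigval 2 (?K M) \<le> 1 - eigval 1 (?K M)"
    if "M \<ge> 1" for M
    using eigval_psd_trace_1[OF sample_cov_carrier N, of M y] sample_cov_sym[of _ N _ M y]
      sample_cov_eigenvalue_nonneg[of y N M] y trace[OF that] by blast+
  show one: "(\<lambda>M. eigval 1 (?K M)) \<longlonglongrightarrow> 1"
  proof (rule tendsto_sandwich[OF _ _ sq tendsto_const])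
    show "\<forall>\<^sub>F M in sequentially. (\<Sum>i<N. \<Sum>j<N. (?K M $$ (i, j))\<^sup>2) \<le> eigval 1 (?K M)"
      using eventually_ge_at_top[of 1] by eventually_elim (rule bounds(1))
    show "\<forall>\<^sub>F M in sequentially. eigval 1 (?K M) \<le> 1"
      using eventually_ge_at_top[of 1] by eventually_elim (rule bounds(2))
  qed
  assume "N \<ge> 2"
  show "(\<lambda>M. eigval 2 (?K M)) \<longlonglongrightarrow> 0"
  proof (rule tendsto_sandwich)
    show "\<forall>\<^sub>F M in sequentially. 0 \<le> eigval 2 (?K M)"
      using eventually_ge_at_top[of 1] by eventually_elim (rule bounds(3)[OF _ \<open>N \<ge> 2\<close>])
    show "\<forall>\<^sub>F M in sequentially. eigval 2 (?K M) \<le> 1 - eigval 1 (?K M)"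
      using eventually_ge_at_top[of 1] by eventually_elim (rule bounds(4)[OF _ \<open>N \<ge> 2\<close>])
    show "(\<lambda>M. 1 - eigval 1 (?K M)) \<longlonglongrightarrow> 0"
      using tendsto_diff[OF tendsto_const one, of 1] by simp
  qed simp
qed

section \<open>Spin configurations and the uniform measure\<close>

lemma finite_configs: "finite (configs N)"
proof (rule finite_subset)
  show "configs N \<subseteq> vec N ` ({..<N} \<rightarrow>\<^sub>E {-1, 1})"
  proof
    fix \<sigma> assume \<sigma>: "\<sigma> \<in> configs N"
    then have "\<sigma> = vec N (\<lambda>i\<in>{..<N}. \<sigma> $ i)" by (intro eq_vecI) (auto simp: configs_def)
    moreover have "(\<lambda>i\<in>{..<N}. \<sigma> $ i) \<in> {..<N} \<rightarrow>\<^sub>E {-1, 1}"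
      using \<sigma> by (auto simp: configs_def)
    ultimately show "\<sigma> \<in> vec N ` ({..<N} \<rightarrow>\<^sub>E {-1, 1})" by blast
  qed
  show "finite (vec N ` ({..<N} \<rightarrow>\<^sub>E {-1, 1 :: real}))" by (intro finite_imageI finite_PiE) auto
qed

lemma flip_spins_configs: "\<sigma> \<in> configs N \<Longrightarrow> flip_spins C \<sigma> \<in> configs N"
  by (auto simp: configs_def flip_spins_def) blast+

lemma flip_spins_involution: "flip_spins C (flip_spins C \<sigma>) = \<sigma>"
  by (auto simp: flip_spins_def)

text \<open>For \<open>i \<noteq> j\<close>, flipping the spin at \<open>i\<close> is an involution of the configuration space that changes
  the sign of the product.\<close>

lemma sum_configs_spin_product:
  assumes "i < N" "j < N"
  shows "(\<Sum>\<sigma>\<in>configs N. \<sigma> $ i * \<sigma> $ j) = (if i = j then real (card (configs N)) else 0)"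
proof (cases "i = j")
  case True
  then show ?thesis using assms spin_square by simp
next
  case False
  have "(\<Sum>\<sigma>\<in>configs N. \<sigma> $ i * \<sigma> $ j) =
      (\<Sum>\<sigma>\<in>configs N. flip_spins {i} \<sigma> $ i * flip_spins {i} \<sigma> $ j)"
    by (rule sum.reindex_bij_witness[of _ "flip_spins {i}" "flip_spins {i}"])
      (auto simp: flip_spins_involution flip_spins_configs)
  also have "\<dots> = (\<Sum>\<sigma>\<in>configs N. - (\<sigma> $ i * \<sigma> $ j))"
    using assms False by (intro sum.cong refl) (auto simp: flip_spins_def configs_def)
  finally show ?thesis using False by (simp add: sum_negf)
qed

lemma gibbs_0_expectation:
  assumes x: "x \<in> carrier_vec N" and "configs N \<noteq> {}"
  shows "integral\<^sup>L (gibbs N 0) (g_fun x) = x \<bullet> x"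
proof -
  let ?c = "real (card (configs N))"
  have c: "?c > 0" using assms(2) finite_configs by (simp add: card_gt_0_iff)
  have "integral\<^sup>L (gibbs N 0) (g_fun x) = (\<Sum>\<sigma>\<in>configs N. 1 / ?c * g_fun x \<sigma>)"
    unfolding gibbs_def point_measure_def
    by (subst integral_density)
      (auto simp: ising_weight_def lebesgue_integral_count_space_finite[OF finite_configs]
        sum_nonneg sum_divide_distrib)
  also have "\<dots> = (\<Sum>\<sigma>\<in>configs N. \<Sum>i<N. \<Sum>j<N. x $ i * x $ j / ?c * (\<sigma> $ i * \<sigma> $ j))"
  proof (rule sum.cong[OF refl])
    fix \<sigma> assume "\<sigma> \<in> configs N"
    have "\<sigma> \<bullet> x = (\<Sum>i<N. \<sigma> $ i * x $ i)"
      using x by (simp add: scalar_prod_def atLeast0LessThan)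
    then have "g_fun x \<sigma> = (\<Sum>i<N. \<Sum>j<N. (\<sigma> $ i * x $ i) * (\<sigma> $ j * x $ j))"
      by (simp add: g_fun_def power2_eq_square sum_product)
    then show "1 / ?c * g_fun x \<sigma> = (\<Sum>i<N. \<Sum>j<N. x $ i * x $ j / ?c * (\<sigma> $ i * \<sigma> $ j))"
      by (simp add: sum_distrib_left sum_divide_distrib mult_ac)
  qed
  also have "\<dots> = (\<Sum>i<N. \<Sum>\<sigma>\<in>configs N. \<Sum>j<N. x $ i * x $ j / ?c * (\<sigma> $ i * \<sigma> $ j))"
    by (rule sum.swap)
  also have "\<dots> = (\<Sum>i<N. \<Sum>j<N. \<Sum>\<sigma>\<in>configs N. x $ i * x $ j / ?c * (\<sigma> $ i * \<sigma> $ j))"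
    by (intro sum.cong refl sum.swap)
  also have "\<dots> = (\<Sum>i<N. \<Sum>j<N. if i = j then x $ i * x $ j else 0)"
    unfolding sum_distrib_left[symmetric]
    using c by (intro sum.cong refl) (simp add: sum_configs_spin_product)
  also have "\<dots> = x \<bullet> x"
    using x by (simp add: scalar_prod_def atLeast0LessThan)
  finally show ?thesis .
qed

section \<open>Time averages in finite Markov chains\<close>

text \<open>Between two consecutive squares \<open>m\<^sup>2\<close> and \<open>(m + 1)\<^sup>2\<close> a sequence with increments bounded by \<open>b\<close>
  drifts by at most \<open>2 b m\<close>, which is negligible against \<open>m\<^sup>2\<close>.\<close>

lemma tendsto_average_from_squares:
  fixes T :: "nat \<Rightarrow> real"
  assumes inc: "\<And>n. \<bar>T (Suc n) - T n\<bar> \<le> b"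
    and sq: "(\<lambda>m. T ((Suc m)\<^sup>2) / real ((Suc m)\<^sup>2)) \<longlonglongrightarrow> 0"
  shows "(\<lambda>n. T n / real n) \<longlonglongrightarrow> 0"
proof -
  have b: "b \<ge> 0" using inc[of 0] by linarith
  have drift: "\<bar>T (m + k) - T m\<bar> \<le> b * real k" for m k
  proof (induction k)
    case (Suc k)
    with inc[of "m + k"] show ?case by (simp add: algebra_simps)
  qed simp
  \<comment> \<open>Shifted by one, so that \<open>Suc (r n)\<close> is the integer square root of every \<open>n \<ge> 1\<close>.\<close>
  define r where "r n = floor_sqrt n - 1" for n
  have r: "filterlim r at_top sequentially"
    unfolding filterlim_at_top
  proof
    fix Z
    show "\<forall>\<^sub>F n in sequentially. Z \<le> r n"
      using eventually_ge_at_top[of "(Z + 1)\<^sup>2"]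
    proof eventually_elim
      case (elim n)
      then have "Z + 1 \<le> floor_sqrt n" by (rule le_floor_sqrtI)
      then show ?case by (simp add: r_def)
    qed
  qed
  let ?g = "\<lambda>m. \<bar>T ((Suc m)\<^sup>2) / real ((Suc m)\<^sup>2)\<bar> + 2 * b * (1 / real (Suc m))"
  have "?g \<longlonglongrightarrow> 0 + 2 * b * 0"
    by (intro tendsto_add tendsto_mult tendsto_const tendsto_rabs_zero sq
        LIMSEQ_Suc[OF lim_1_over_n])
  then have "(\<lambda>n. ?g (r n)) \<longlonglongrightarrow> 0"
    using filterlim_compose[OF _ r] by fastforce
  moreover have "\<forall>\<^sub>F n in sequentially. norm (T n / real n) \<le> ?g (r n)"
    using eventually_ge_at_top[of 1]
  proof eventually_elim
    case (elim n)
    define m where "m = floor_sqrt n"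
    have m: "m \<ge> 1" "Suc (r n) = m" using elim floor_sqrt_greater_zero_iff[of n]
      by (auto simp: m_def r_def simp del: floor_sqrt_greater_zero_iff)
    have le: "m\<^sup>2 \<le> n" by (simp add: m_def)
    have "n < (Suc m)\<^sup>2" unfolding m_def by (rule Suc_floor_sqrt_power2_gt)
    then have k: "n - m\<^sup>2 \<le> 2 * m" by (simp add: power2_eq_square)
    have "\<bar>T n - T (m\<^sup>2)\<bar> \<le> b * real (n - m\<^sup>2)" using drift[of "m\<^sup>2" "n - m\<^sup>2"] le by simp
    also have "\<dots> \<le> b * real (2 * m)" using k b by (intro mult_left_mono) linarith+
    finally have T: "\<bar>T n\<bar> \<le> \<bar>T (m\<^sup>2)\<bar> + 2 * b * real m" by simp
    have "norm (T n / real n) \<le> (\<bar>T (m\<^sup>2)\<bar> + 2 * b * real m) / real n"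
      using T by (simp add: divide_right_mono)
    also have "\<dots> \<le> (\<bar>T (m\<^sup>2)\<bar> + 2 * b * real m) / real (m\<^sup>2)"
    proof (rule divide_left_mono)
      have "0 < real n" "0 < real (m\<^sup>2)" using elim m(1) by auto
      then show "0 < real n * real (m\<^sup>2)" by (rule mult_pos_pos)
    qed (use b le in auto)
    also have "\<dots> = ?g (r n)" using m by (simp add: add_divide_distrib power2_eq_square)
    finally show ?case .
  qed
  ultimately show ?thesis by (rule Lim_null_comparison[rotated])
qed

context prob_space
begin

lemma expectation_finite_range:
  fixes g :: "'b \<Rightarrow> real"
  assumes X: "X \<in> measurable M (count_space A)" and "finite A"
  shows "expectation (\<lambda>\<omega>. g (X \<omega>)) = (\<Sum>a\<in>A. g a * prob {\<omega> \<in> space M. X \<omega> = a})"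
proof -
  have ev: "{\<omega> \<in> space M. X \<omega> = a} \<in> events" if "a \<in> A" for a
    using measurable_sets[OF X, of "{a}"] that by (simp add: vimage_def Int_def conj_commute)
  have "expectation (\<lambda>\<omega>. g (X \<omega>)) =
      expectation (\<lambda>\<omega>. \<Sum>a\<in>A. g a * indicator {\<omega> \<in> space M. X \<omega> = a} \<omega>)"
  proof (rule Bochner_Integration.integral_cong[OF refl])
    fix \<omega> assume \<omega>: "\<omega> \<in> space M"
    then have "X \<omega> \<in> A" using measurable_space[OF X] by simp
    then show "g (X \<omega>) = (\<Sum>a\<in>A. g a * indicator {\<omega> \<in> space M. X \<omega> = a} \<omega>)"
      using \<omega> \<open>finite A\<close> by (simp add: indicator_def if_distrib[of "(*) _"] cong: if_cong)
  qed
  also have "\<dots> = (\<Sum>a\<in>A. g a * prob {\<omega> \<in> space M. X \<omega> = a})"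
    using ev by (subst Bochner_Integration.integral_sum) (auto simp: emeasure_eq_measure)
  finally show ?thesis .
qed

lemma integrable_finite_range:
  fixes g :: "'b \<Rightarrow> real"
  assumes X: "X \<in> measurable M (count_space A)" and "finite A"
  shows "integrable M (\<lambda>\<omega>. g (X \<omega>))"
proof (rule integrable_const_bound)
  show "AE \<omega> in M. norm (g (X \<omega>)) \<le> (\<Sum>a\<in>A. \<bar>g a\<bar>)"
  proof (rule AE_I2)
    fix \<omega> assume "\<omega> \<in> space M"
    then have "X \<omega> \<in> A" using measurable_space[OF X] by simp
    then show "norm (g (X \<omega>)) \<le> (\<Sum>a\<in>A. \<bar>g a\<bar>)"
      using member_le_sum[of "X \<omega>" A "\<lambda>a. \<bar>g a\<bar>"] \<open>finite A\<close> by simp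
  qed
  show "(\<lambda>\<omega>. g (X \<omega>)) \<in> borel_measurable M"
    by (rule measurable_compose[OF X]) simp
qed

text \<open>A strong law for sequences whose second moments grow at most linearly. Along the squares
  \<open>n = m\<^sup>2\<close> the second moments of \<open>T\<^sub>n / n\<close> are at most \<open>c / m\<^sup>2\<close>, hence summable, so the sum over \<open>m\<close>
  of the squares \<open>(T\<^sub>n / n)\<^sup>2\<close> is a.s. finite and its terms tend to \<open>0\<close>. Bounded increments fill the
  gaps.\<close>

lemma AE_average_tendsto_0:
  fixes T :: "nat \<Rightarrow> 'a \<Rightarrow> real"
  assumes rv: "\<And>n. T n \<in> borel_measurable M"
    and int: "\<And>n. integrable M (\<lambda>\<omega>. (T n \<omega>)\<^sup>2)"
    and var: "\<And>n. expectation (\<lambda>\<omega>. (T n \<omega>)\<^sup>2) \<le> c * real n"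
    and inc: "\<And>n \<omega>. \<omega> \<in> space M \<Longrightarrow> \<bar>T (Suc n) \<omega> - T n \<omega>\<bar> \<le> b"
  shows "AE \<omega> in M. (\<lambda>n. T n \<omega> / real n) \<longlonglongrightarrow> 0"
proof -
  define q where "q m \<omega> = (T ((Suc m)\<^sup>2) \<omega> / real ((Suc m)\<^sup>2))\<^sup>2" for m \<omega>
  have [measurable]: "\<And>n. T n \<in> borel_measurable M" by (rule rv)
  have qm: "q m \<in> borel_measurable M" for m unfolding q_def by measurable
  have "0 \<le> expectation (\<lambda>\<omega>. (T 1 \<omega>)\<^sup>2)"
    by (rule integral_nonneg_AE) simp
  from order_trans[OF this var[of 1]] have c: "c \<ge> 0" by simp
  have Eq: "(\<integral>\<^sup>+\<omega>. ennreal (q m \<omega>) \<partial>M) \<le> ennreal (c * (1 / (real (Suc m))\<^sup>2))" for m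
  proof -
    have qeq: "q m = (\<lambda>\<omega>. (T ((Suc m)\<^sup>2) \<omega>)\<^sup>2 / (real ((Suc m)\<^sup>2))\<^sup>2)"
      by (simp add: q_def power_divide fun_eq_iff)
    have "(\<integral>\<^sup>+\<omega>. ennreal (q m \<omega>) \<partial>M) = ennreal (expectation (q m))"
      unfolding qeq using int by (intro nn_integral_eq_integral) auto
    also have "expectation (q m) \<le> c * real ((Suc m)\<^sup>2) / (real ((Suc m)\<^sup>2))\<^sup>2"
      unfolding qeq using var[of "(Suc m)\<^sup>2"] by (simp add: divide_right_mono del: of_nat_power of_nat_Suc)
    also have "\<dots> = c * (1 / (real (Suc m))\<^sup>2)"
    proof -
      have "c * r\<^sup>2 / (r\<^sup>2)\<^sup>2 = c * (1 / r\<^sup>2)" if "r \<noteq> 0" for r :: real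
        using that by (simp add: field_simps power2_eq_square)
      from this[of "real (Suc m)"] show ?thesis unfolding of_nat_power by (simp del: of_nat_Suc)
    qed
    finally show ?thesis by (simp add: ennreal_leI)
  qed
  have "(\<integral>\<^sup>+\<omega>. (\<Sum>m. ennreal (q m \<omega>)) \<partial>M) = (\<Sum>m. \<integral>\<^sup>+\<omega>. ennreal (q m \<omega>) \<partial>M)"
    using qm by (intro nn_integral_suminf) auto
  also have "\<dots> \<le> (\<Sum>m. ennreal (c * (1 / (real (Suc m))\<^sup>2)))"
    by (intro suminf_le Eq) auto
  also have "\<dots> < \<infinity>"
  proof -
    have "summable (\<lambda>m. c * (1 / (real (Suc m))\<^sup>2))"
      using inverse_squares_sums by (intro summable_mult) (auto simp: sums_iff add_ac)
    then show ?thesis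
      unfolding infinity_ennreal_def less_top[symmetric]
      by (rule ennreal_suminf_neq_top) (use c in simp)
  qed
  finally have "AE \<omega> in M. (\<Sum>m. ennreal (q m \<omega>)) \<noteq> \<infinity>"
    using qm by (intro nn_integral_PInf_AE) auto
  then show ?thesis
  proof (rule AE_mp, intro AE_I2 impI)
    fix \<omega> assume \<omega>: "\<omega> \<in> space M" and fin: "(\<Sum>m. ennreal (q m \<omega>)) \<noteq> \<infinity>"
    have "summable (\<lambda>m. q m \<omega>)"
      using fin by (intro summable_suminf_not_top) (auto simp: q_def)
    then have "(\<lambda>m. q m \<omega>) \<longlonglongrightarrow> 0" by (rule summable_LIMSEQ_zero)
    then have "(\<lambda>m. T ((Suc m)\<^sup>2) \<omega> / real ((Suc m)\<^sup>2)) \<longlonglongrightarrow> 0"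
      unfolding q_def by (simp only: power_tendsto_0_iff[OF pos2])
    with inc[OF \<omega>] show "(\<lambda>n. T n \<omega> / real n) \<longlonglongrightarrow> 0"
      by (rule tendsto_average_from_squares)
  qed
qed

end

text \<open>Time starts at \<open>1\<close>. The Markov property is given by elementary conditional probabilities on finite
  histories. As there are finitely many of these, expectations of functions of the history are
  finite sums.\<close>

locale finite_markov_chain = prob_space P for P :: "'w measure" +
  fixes S :: "'s set" and K :: "'s \<Rightarrow> 's pmf" and Y :: "nat \<Rightarrow> 'w \<Rightarrow> 's"
  assumes finite_states: "finite S"
    and kernel_closed: "\<And>s. s \<in> S \<Longrightarrow> set_pmf (K s) \<subseteq> S"
    and Y_measurable: "\<And>k. k \<ge> 1 \<Longrightarrow> Y k \<in> measurable P (count_space S)"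
    and markov: "\<And>n s. n \<ge> 1 \<Longrightarrow> \<P>(\<omega> in P. \<forall>k\<in>{1..n}. Y k \<omega> = s k) \<noteq> 0 \<Longrightarrow>
      \<P>(\<omega> in P. Y (n + 1) \<omega> = s (n + 1) \<bar> \<forall>k\<in>{1..n}. Y k \<omega> = s k) = pmf (K (s n)) (s (n + 1))"
begin

definition history :: "nat \<Rightarrow> 'w \<Rightarrow> nat \<Rightarrow> 's" where
  "history n \<omega> = (\<lambda>k\<in>{1..n}. Y k \<omega>)"

definition histories :: "nat \<Rightarrow> (nat \<Rightarrow> 's) set" where
  "histories n = {1..n} \<rightarrow>\<^sub>E S"

lemma finite_histories: "finite (histories n)"
  by (simp add: histories_def finite_states finite_PiE)

lemma Y_in_states: "k \<ge> 1 \<Longrightarrow> \<omega> \<in> space P \<Longrightarrow> Y k \<omega> \<in> S"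
  using measurable_space[OF Y_measurable] by simp

lemma event_Y:
  assumes "k \<ge> 1"
  shows "{\<omega> \<in> space P. Y k \<omega> = t} \<in> events"
proof -
  have "Y k -` ({t} \<inter> S) \<inter> space P \<in> events"
    using assms by (intro measurable_sets[OF Y_measurable]) auto
  also have "Y k -` ({t} \<inter> S) \<inter> space P = {\<omega> \<in> space P. Y k \<omega> = t}"
    using Y_in_states[OF assms] by auto
  finally show ?thesis .
qed

lemma event_history: "{\<omega> \<in> space P. \<forall>k\<in>{1..n}. Y k \<omega> = p k} \<in> events"
  by (intro sets.sets_Collect_finite_All event_Y) auto

lemma history_eq_iff: "p \<in> histories n \<Longrightarrow> history n \<omega> = p \<longleftrightarrow> (\<forall>k\<in>{1..n}. Y k \<omega> = p k)"
  by (auto simp: history_def histories_def fun_eq_iff PiE_def extensional_def restrict_def)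

lemma history_in_histories: "\<omega> \<in> space P \<Longrightarrow> history n \<omega> \<in> histories n"
  using Y_in_states by (auto simp: history_def histories_def)

lemma history_measurable: "history n \<in> measurable P (count_space (histories n))"
proof (rule measurable_count_space_eq2[THEN iffD2, OF finite_histories], intro conjI ballI)
  show "history n \<in> space P \<rightarrow> histories n" using history_in_histories by auto
  fix p assume "p \<in> histories n"
  then have "history n -` {p} \<inter> space P = {\<omega> \<in> space P. \<forall>k\<in>{1..n}. Y k \<omega> = p k}"
    using history_eq_iff by blast
  then show "history n -` {p} \<inter> space P \<in> events" using event_history by simp
qed

lemma history_step_measurable:
  "(\<lambda>\<omega>. (history n \<omega>, Y (n + 1) \<omega>)) \<in> measurable P (count_space (histories n \<times> S))"
proof (rule measurable_count_space_eq2[THEN iffD2, OF finite_cartesian_product[OF finite_histories finite_states]],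
    intro conjI ballI)
  show "(\<lambda>\<omega>. (history n \<omega>, Y (n + 1) \<omega>)) \<in> space P \<rightarrow> histories n \<times> S"
    using history_in_histories Y_in_states by auto
  fix z assume "z \<in> histories n \<times> S"
  then obtain p t where z: "z = (p, t)" "p \<in> histories n" by auto
  have "(\<lambda>\<omega>. (history n \<omega>, Y (n + 1) \<omega>)) -` {z} \<inter> space P =
    {\<omega> \<in> space P. \<forall>k\<in>{1..n}. Y k \<omega> = p k} \<inter> {\<omega> \<in> space P. Y (n + 1) \<omega> = t}"
    using z history_eq_iff[OF z(2)] by auto
  then show "(\<lambda>\<omega>. (history n \<omega>, Y (n + 1) \<omega>)) -` {z} \<inter> space P \<in> events"
    using event_history event_Y[of "n + 1" t] by auto
qed

lemma prob_history_step:
  assumes n: "n \<ge> 1" and p: "p \<in> histories n"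
  shows "prob {\<omega> \<in> space P. (history n \<omega>, Y (n + 1) \<omega>) = (p, t)} =
    prob {\<omega> \<in> space P. history n \<omega> = p} * pmf (K (p n)) t"
proof -
  define s where "s = p(n + 1 := t)"
  let ?A = "{\<omega> \<in> space P. \<forall>k\<in>{1..n}. Y k \<omega> = s k}"
  let ?B = "{\<omega> \<in> space P. Y (n + 1) \<omega> = s (n + 1) \<and> (\<forall>k\<in>{1..n}. Y k \<omega> = s k)}"
  have eqA: "{\<omega> \<in> space P. history n \<omega> = p} = ?A"
    using p by (auto simp: history_eq_iff s_def)
  have eqB: "{\<omega> \<in> space P. (history n \<omega>, Y (n + 1) \<omega>) = (p, t)} = ?B"
    using p by (auto simp: history_eq_iff s_def)
  have sn: "s n = p n" "s (Suc n) = t" by (simp_all add: s_def)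
  have "prob ?B = prob ?A * pmf (K (p n)) t"
  proof (cases "prob ?A = 0")
    case True
    have "prob ?B \<le> prob ?A" by (intro finite_measure_mono event_history) auto
    with True measure_nonneg[of P ?B] have "prob ?B = 0" by linarith
    with True show ?thesis by simp
  next
    case False
    from markov[OF n this] show ?thesis
      using False by (simp add: cond_prob_def sn field_simps)
  qed
  then show ?thesis unfolding eqA eqB .
qed

text \<open>Conditioning on the history up to time \<open>n\<close>: given the history, the next state has the law
  prescribed by the kernel at the current state.\<close>

lemma expectation_step:
  fixes H :: "(nat \<Rightarrow> 's) \<Rightarrow> 's \<Rightarrow> real"
  assumes n: "n \<ge> 1"
  shows "expectation (\<lambda>\<omega>. H (history n \<omega>) (Y (n + 1) \<omega>)) =
    expectation (\<lambda>\<omega>. \<integral>t. H (history n \<omega>) t \<partial>measure_pmf (K (history n \<omega> n)))"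
proof -
  have "expectation (\<lambda>\<omega>. H (history n \<omega>) (Y (n + 1) \<omega>)) =
    (\<Sum>(p, t)\<in>histories n \<times> S. H p t * (prob {\<omega> \<in> space P. history n \<omega> = p} * pmf (K (p n)) t))"
    using expectation_finite_range[OF history_step_measurable[of n], of "\<lambda>(p, t). H p t"] finite_histories
      finite_states prob_history_step[OF n] by (auto intro!: sum.cong)
  also have "\<dots> = (\<Sum>p\<in>histories n. (\<Sum>t\<in>S. H p t * pmf (K (p n)) t) *
      prob {\<omega> \<in> space P. history n \<omega> = p})"
    by (simp add: sum.cartesian_product[symmetric] sum_distrib_right mult_ac)
  also have "\<dots> = (\<Sum>p\<in>histories n. (\<integral>t. H p t \<partial>measure_pmf (K (p n))) *
      prob {\<omega> \<in> space P. history n \<omega> = p})"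
  proof (rule sum.cong[OF refl])
    fix p assume "p \<in> histories n"
    then have "p n \<in> S" using n by (auto simp: histories_def)
    then show "(\<Sum>t\<in>S. H p t * pmf (K (p n)) t) * prob {\<omega> \<in> space P. history n \<omega> = p} =
        (\<integral>t. H p t \<partial>measure_pmf (K (p n))) * prob {\<omega> \<in> space P. history n \<omega> = p}"
      using kernel_closed by (subst integral_measure_pmf_real[OF finite_states]) auto
  qed
  also have "\<dots> = expectation (\<lambda>\<omega>. \<integral>t. H (history n \<omega>) t \<partial>measure_pmf (K (history n \<omega> n)))"
    by (rule expectation_finite_range[OF history_measurable finite_histories, symmetric])
  finally show ?thesis .
qed

text \<open>The indicator of an impossible transition has expectation \<open>0\<close> under the kernel, hence under
  the chain.\<close>

lemma AE_step_possible:
  "AE \<omega> in P. \<forall>n\<ge>1. Y (n + 1) \<omega> \<in> set_pmf (K (Y n \<omega>))"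
proof -
  have "AE \<omega> in P. Y (n + 1) \<omega> \<in> set_pmf (K (Y n \<omega>))" if n: "n \<ge> 1" for n
  proof -
    define H :: "(nat \<Rightarrow> 's) \<Rightarrow> 's \<Rightarrow> real" where "H p t = of_bool (t \<notin> set_pmf (K (p n)))" for p t
    have "(\<integral>t. H p t \<partial>measure_pmf (K (p n))) = 0" for p
    proof -
      have "(\<integral>t. H p t \<partial>measure_pmf (K (p n))) = (\<integral>t. 0 \<partial>measure_pmf (K (p n)))"
        by (intro integral_cong_AE) (auto simp: AE_measure_pmf_iff H_def)
      then show ?thesis by simp
    qed
    then have "expectation (\<lambda>\<omega>. H (history n \<omega>) (Y (n + 1) \<omega>)) = 0"
      by (simp only: expectation_step[OF n]) simp
    moreover have "integrable P (\<lambda>\<omega>. H (history n \<omega>) (Y (n + 1) \<omega>))"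
      using integrable_finite_range[OF history_step_measurable[of n], of "\<lambda>(p, t). H p t"]
        finite_histories finite_states by simp
    ultimately have "AE \<omega> in P. H (history n \<omega>) (Y (n + 1) \<omega>) = 0"
      by (subst (asm) integral_nonneg_eq_0_iff_AE) (auto simp: H_def)
    then show ?thesis
      by (rule AE_mp) (use n in \<open>auto simp: H_def history_def\<close>)
  qed
  then show ?thesis by (auto simp: AE_all_countable)
qed

text \<open>If the kernel maps \<open>f\<close> to \<open>\<theta> f\<close>, then \<open>f (Y\<^sub>k\<^sub>+\<^sub>1) - \<theta> f (Y\<^sub>k)\<close> has conditional expectation \<open>0\<close> given the
  history up to time \<open>k\<close>. The partial sums \<open>T\<^sub>n\<close> of these differences form a martingale with bounded
  increments; the increments are orthogonal in \<open>L\<^sup>2\<close>, so the second moment of \<open>T\<^sub>n\<close> grows at most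
  linearly and \<open>T\<^sub>n / n \<longlonglongrightarrow> 0\<close> almost surely. Shifting the index expresses \<open>(1 - \<theta>) \<Sum>\<^sub>k f (Y\<^sub>k)\<close> as
  \<open>T\<^sub>n\<close> plus two boundary terms, and \<open>1 - \<theta>\<close> can be divided out.\<close>

lemma time_average_eigenfunction:
  fixes f :: "'s \<Rightarrow> real"
  assumes eigen: "\<And>s. s \<in> S \<Longrightarrow> (\<integral>t. f t \<partial>measure_pmf (K s)) = \<theta> * f s" and "\<theta> \<noteq> 1"
  shows "AE \<omega> in P. (\<lambda>n. (\<Sum>k=1..n. f (Y k \<omega>)) / real n) \<longlonglongrightarrow> 0"
proof -
  define c where "c = (\<Sum>s\<in>S. \<bar>f s\<bar>)"
  have c: "\<bar>f s\<bar> \<le> c" if "s \<in> S" for s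
    unfolding c_def using that finite_states by (intro member_le_sum) auto
  define b where "b = c + \<bar>\<theta>\<bar> * c"
  have incr: "\<bar>f t - \<theta> * f s\<bar> \<le> b" if "s \<in> S" "t \<in> S" for s t
  proof -
    have "\<bar>f t - \<theta> * f s\<bar> \<le> \<bar>f t\<bar> + \<bar>\<theta>\<bar> * \<bar>f s\<bar>"
      using abs_triangle_ineq4[of "f t" "\<theta> * f s"] by (simp add: abs_mult)
    also have "\<dots> \<le> b"
      unfolding b_def by (intro add_mono mult_left_mono c that) auto
    finally show ?thesis .
  qed
  \<comment> \<open>The martingale as a function of the history, as required by \<open>expectation_step\<close>.\<close>
  define G where "G n p = (\<Sum>k=1..n. f (p (Suc k)) - \<theta> * f (p k))" for n and p :: "nat \<Rightarrow> 's"
  define T where "T n \<omega> = G n (\<lambda>k. Y k \<omega>)" for n \<omega>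
  have T_history: "T n \<omega> = G n (history (Suc n) \<omega>)" for n \<omega>
    unfolding T_def G_def by (intro sum.cong) (auto simp: history_def)
  have T_Suc: "T (Suc n) \<omega> = T n \<omega> + (f (Y (Suc n + 1) \<omega>) - \<theta> * f (Y (Suc n) \<omega>))" for n \<omega>
    by (simp add: T_def G_def)
  have T_int: "integrable P (\<lambda>\<omega>. g (T n \<omega>))" for n and g :: "real \<Rightarrow> real"
    unfolding T_history by (rule integrable_finite_range[OF history_measurable finite_histories])
  have T_inc: "\<bar>T (Suc n) \<omega> - T n \<omega>\<bar> \<le> b" if "\<omega> \<in> space P" for n \<omega>
    using incr[OF Y_in_states Y_in_states, OF _ that _ that] by (simp add: T_Suc)
  have T_var: "expectation (\<lambda>\<omega>. (T n \<omega>)\<^sup>2) \<le> b\<^sup>2 * real n" for n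
  proof (induction n)
    case 0
    then show ?case by (simp add: T_def G_def)
  next
    case (Suc n)
    let ?D = "\<lambda>\<omega>. f (Y (Suc n + 1) \<omega>) - \<theta> * f (Y (Suc n) \<omega>)"
    \<comment> \<open>The cross term in the square of \<open>T\<^sub>n\<^sub>+\<^sub>1\<close>; its conditional mean given the history vanishes.\<close>
    define H where "H p t = G n p * (f t - \<theta> * f (p (Suc n)))" for p t
    have H: "T n \<omega> * ?D \<omega> = H (history (Suc n) \<omega>) (Y (Suc n + 1) \<omega>)" for \<omega>
      unfolding T_history H_def by (simp add: history_def)
    have int_TD: "integrable P (\<lambda>\<omega>. T n \<omega> * ?D \<omega>)"
      using integrable_finite_range[OF history_step_measurable[of "Suc n"], of "\<lambda>(p, t). H p t"]
        finite_histories finite_states unfolding H by simp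
    have int_D: "integrable P (\<lambda>\<omega>. (?D \<omega>)\<^sup>2)"
      using integrable_finite_range[OF history_step_measurable[of "Suc n"], of
          "\<lambda>(p, t). (f t - \<theta> * f (p (Suc n)))\<^sup>2"] finite_histories finite_states
      by (simp add: history_def)
    have "expectation (\<lambda>\<omega>. T n \<omega> * ?D \<omega>) =
        expectation (\<lambda>\<omega>. \<integral>t. H (history (Suc n) \<omega>) t \<partial>measure_pmf (K (history (Suc n) \<omega> (Suc n))))"
      unfolding H by (rule expectation_step) simp
    also have "\<dots> = expectation (\<lambda>\<omega>. 0)"
    proof (rule Bochner_Integration.integral_cong[OF refl])
      fix \<omega> assume "\<omega> \<in> space P"
      define p where "p = history (Suc n) \<omega>"
      have s: "p (Suc n) \<in> S"
        using Y_in_states[OF _ \<open>\<omega> \<in> space P\<close>] by (simp add: p_def history_def)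
      have "integrable (measure_pmf (K (p (Suc n)))) f"
        using kernel_closed[OF s] finite_states
        by (intro integrable_measure_pmf_finite) (rule finite_subset)
      then show "(\<integral>t. H (history (Suc n) \<omega>) t \<partial>measure_pmf (K (history (Suc n) \<omega> (Suc n)))) = 0"
        using eigen[OF s] by (simp add: H_def p_def[symmetric])
    qed
    finally have orth: "expectation (\<lambda>\<omega>. T n \<omega> * ?D \<omega>) = 0" by simp
    have "expectation (\<lambda>\<omega>. (?D \<omega>)\<^sup>2) \<le> expectation (\<lambda>\<omega>. b\<^sup>2)"
    proof (rule integral_mono[OF int_D])
      fix \<omega> assume "\<omega> \<in> space P"
      then have "\<bar>?D \<omega>\<bar> \<le> b" by (intro incr Y_in_states) auto
      then show "(?D \<omega>)\<^sup>2 \<le> b\<^sup>2" using power_mono[of "\<bar>?D \<omega>\<bar>" b 2] by simp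
    qed simp
    then have D2: "expectation (\<lambda>\<omega>. (?D \<omega>)\<^sup>2) \<le> b\<^sup>2" by (simp add: prob_space)
    have "expectation (\<lambda>\<omega>. (T (Suc n) \<omega>)\<^sup>2) =
        expectation (\<lambda>\<omega>. (T n \<omega>)\<^sup>2 + 2 * (T n \<omega> * ?D \<omega>) + (?D \<omega>)\<^sup>2)"
      unfolding T_Suc by (simp add: power2_sum mult.assoc add_ac)
    also have "\<dots> = expectation (\<lambda>\<omega>. (T n \<omega>)\<^sup>2) + 2 * expectation (\<lambda>\<omega>. T n \<omega> * ?D \<omega>) +
        expectation (\<lambda>\<omega>. (?D \<omega>)\<^sup>2)"
      using T_int[of "\<lambda>x. x\<^sup>2" n] int_TD int_D by simp
    finally show ?case using Suc D2 orth by (simp add: algebra_simps)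
  qed
  have "AE \<omega> in P. (\<lambda>n. T n \<omega> / real n) \<longlonglongrightarrow> 0"
    using T_int[of "\<lambda>x. x"] T_int[of "\<lambda>x. x\<^sup>2"] T_var T_inc
    by (intro AE_average_tendsto_0[where c = "b\<^sup>2" and b = b]) auto
  then show ?thesis
  proof (rule AE_mp, intro AE_I2 impI)
    fix \<omega> assume \<omega>: "\<omega> \<in> space P" and lim: "(\<lambda>n. T n \<omega> / real n) \<longlonglongrightarrow> 0"
    \<comment> \<open>Telescoping; the two boundary terms are bounded and vanish after division by \<open>n\<close>.\<close>
    have tele: "(1 - \<theta>) * (\<Sum>k=1..n. f (Y k \<omega>)) = T n \<omega> + (f (Y 1 \<omega>) - f (Y (Suc n) \<omega>))" for n
    proof (induction n)
      case (Suc n)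
      have "(1 - \<theta>) * (\<Sum>k=1..Suc n. f (Y k \<omega>)) =
          (1 - \<theta>) * (\<Sum>k=1..n. f (Y k \<omega>)) + (1 - \<theta>) * f (Y (Suc n) \<omega>)"
        by (simp add: distrib_left)
      also have "\<dots> = T (Suc n) \<omega> + (f (Y 1 \<omega>) - f (Y (Suc (Suc n)) \<omega>))"
        unfolding Suc.IH T_Suc by (simp add: algebra_simps)
      finally show ?case .
    qed (simp add: T_def G_def)
    have eq: "(\<Sum>k=1..n. f (Y k \<omega>)) / real n =
        (T n \<omega> / real n + (f (Y 1 \<omega>) - f (Y (Suc n) \<omega>)) / real n) / (1 - \<theta>)" for n
      using \<open>\<theta> \<noteq> 1\<close> by (simp only: add_divide_distrib[symmetric] tele[of n, symmetric]) simp
    have "(\<lambda>n. (f (Y 1 \<omega>) - f (Y (Suc n) \<omega>)) / real n) \<longlonglongrightarrow> 0"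
    proof (rule Lim_null_comparison)
      show "\<forall>\<^sub>F n in sequentially. norm ((f (Y 1 \<omega>) - f (Y (Suc n) \<omega>)) / real n) \<le> 2 * c * (1 / real n)"
      proof (rule always_eventually, rule allI)
        fix n
        have "\<bar>f (Y 1 \<omega>) - f (Y (Suc n) \<omega>)\<bar> \<le> 2 * c"
          using c[OF Y_in_states[OF _ \<omega>], of 1] c[OF Y_in_states[OF _ \<omega>], of "Suc n"] by auto
        then show "norm ((f (Y 1 \<omega>) - f (Y (Suc n) \<omega>)) / real n) \<le> 2 * c * (1 / real n)"
          by (simp add: divide_right_mono)
      qed
      show "(\<lambda>n. 2 * c * (1 / real n)) \<longlonglongrightarrow> 0"
        using tendsto_mult[OF tendsto_const lim_1_over_n, of "2 * c"] by simp
    qed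
    from tendsto_divide[OF tendsto_add[OF lim this] tendsto_const[of "1 - \<theta>"]] \<open>\<theta> \<noteq> 1\<close>
    show "(\<lambda>n. (\<Sum>k=1..n. f (Y k \<omega>)) / real n) \<longlonglongrightarrow> 0"
      unfolding eq by simp
  qed
qed

end

section \<open>The Wolff dynamics as a Markov chain\<close>

lemma wolff_step_configs:
  assumes "\<sigma> \<in> configs N" "N \<ge> 1" "\<tau> \<in> set_pmf (wolff_step N J \<sigma>)"
  shows "\<tau> \<in> configs N"
  using assms by (auto simp: wolff_step_def flip_spins_configs)

lemma wolff_dynamics_markov_chain:
  assumes "N \<ge> 1" and W: "wolff_dynamics N J y P Y"
  shows "finite_markov_chain P (configs N) (wolff_step N J) Y"
proof -
  interpret prob_space P using W by (simp add: wolff_dynamics_def)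
  show ?thesis
  proof
    show "finite (configs N)" by (rule finite_configs)
    show "set_pmf (wolff_step N J \<sigma>) \<subseteq> configs N" if "\<sigma> \<in> configs N" for \<sigma>
      using wolff_step_configs[OF that assms(1)] by blast
    show "Y k \<in> measurable P (count_space (configs N))" if "k \<ge> 1" for k
      using W that unfolding wolff_dynamics_def by blast
    show "\<P>(\<omega> in P. Y (n + 1) \<omega> = s (n + 1) \<bar> \<forall>k\<in>{1..n}. Y k \<omega> = s k)
        = pmf (wolff_step N J (s n)) (s (n + 1))"
      if "n \<ge> 1" "\<P>(\<omega> in P. \<forall>k\<in>{1..n}. Y k \<omega> = s k) \<noteq> 0" for n s
      using W that unfolding wolff_dynamics_def by blast
  qed
qed

section \<open>Zero coupling\<close>

text \<open>At zero coupling no bond is ever opened: every pending edge is inspected in vain.\<close>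

lemma wolff_cluster_0: "J = 0 \<Longrightarrow> wolff_cluster N J \<sigma> C D = return_pmf C"
proof (induction N J \<sigma> C D rule: wolff_cluster.induct)
  case (1 N J \<sigma> C D)
  have "bernoulli_pmf (bond_prob J) = return_pmf False"
    using 1 by (intro pmf_eqI) (auto simp: bond_prob_def pmf_return indicator_def)
  with 1 show ?case
    by (subst wolff_cluster.simps) (auto simp: Let_def bind_return_pmf)
qed

lemma wolff_step_0: "wolff_step N 0 \<sigma> = map_pmf (\<lambda>i. flip_spins {i} \<sigma>) (pmf_of_set {..<N})"
  by (simp add: wolff_step_def wolff_cluster_0 map_pmf_def bind_return_pmf)

text \<open>Of the \<open>N\<close> equally likely flips exactly two, those at \<open>i\<close> and at \<open>j\<close>, change the sign of the
  product, so its mean is multiplied by \<open>(N - 4) / N\<close>.\<close>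

lemma spin_product_eigenfunction:
  assumes \<sigma>: "\<sigma> \<in> configs N" and "N \<ge> 1" "i < N" "j < N" "i \<noteq> j"
  shows "(\<integral>\<tau>. \<tau> $ i * \<tau> $ j \<partial>measure_pmf (wolff_step N 0 \<sigma>)) = (1 - 4 / real N) * (\<sigma> $ i * \<sigma> $ j)"
proof -
  have ne: "{..<N} \<noteq> {}" using assms by auto
  have "(\<integral>\<tau>. \<tau> $ i * \<tau> $ j \<partial>measure_pmf (wolff_step N 0 \<sigma>)) =
      (\<Sum>l<N. flip_spins {l} \<sigma> $ i * flip_spins {l} \<sigma> $ j) / real N"
    using ne by (simp add: wolff_step_0 integral_pmf_of_set)
  also have "(\<Sum>l<N. flip_spins {l} \<sigma> $ i * flip_spins {l} \<sigma> $ j) =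
      (\<Sum>l<N. \<sigma> $ i * \<sigma> $ j - (if l = i then 2 * (\<sigma> $ i * \<sigma> $ j) else 0)
        - (if l = j then 2 * (\<sigma> $ i * \<sigma> $ j) else 0))"
    using assms by (intro sum.cong refl) (auto simp: flip_spins_def configs_def)
  also have "\<dots> = (real N - 4) * (\<sigma> $ i * \<sigma> $ j)"
    using assms by (simp add: sum_subtractf algebra_simps)
  finally show ?thesis using assms by (simp add: field_simps)
qed

section \<open>Infinite coupling\<close>

text \<open>Connectedness of the cycle: every site is reached from any other by going around.\<close>

lemma cyclic_shift_closed_eq_all:
  fixes N :: nat
  assumes S: "S \<subseteq> {..<N}" and "S \<noteq> {}" and closed: "\<And>e. e \<in> S \<Longrightarrow> (e + 1) mod N \<in> S"
  shows "S = {..<N}"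
proof
  obtain i where i: "i \<in> S" using \<open>S \<noteq> {}\<close> by blast
  then have iN: "i < N" using S by auto
  have reach: "(i + k) mod N \<in> S" for k
  proof (induction k)
    case (Suc k)
    have "((i + k) mod N + 1) mod N = (i + Suc k) mod N" by (simp add: mod_simps)
    with closed[OF Suc] show ?case by simp
  qed (use i iN in simp)
  show "{..<N} \<subseteq> S"
  proof
    fix j assume "j \<in> {..<N}"
    then have "(i + (N - i + j)) mod N = j" using iN by simp
    with reach[of "N - i + j"] show "j \<in> S" by simp
  qed
qed (rule S)

text \<open>The domain walls of statistical mechanics.\<close>

definition walls :: "nat \<Rightarrow> real vec \<Rightarrow> nat set" where
  "walls N \<sigma> = {e. e < N \<and> \<sigma> $ e \<noteq> \<sigma> $ ((e + 1) mod N)}"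

lemma no_walls_constant:
  assumes "walls N \<sigma> = {}" "i < N" "j < N"
  shows "\<sigma> $ i = \<sigma> $ j"
proof -
  have agree: "\<sigma> $ ((e + 1) mod N) = \<sigma> $ e" if "e < N" for e
  proof -
    have "e \<notin> walls N \<sigma>" using assms(1) by simp
    with that show ?thesis by (simp add: walls_def)
  qed
  have "{k. k < N \<and> \<sigma> $ k = \<sigma> $ j} = {..<N}"
    using assms(3) agree by (intro cyclic_shift_closed_eq_all) auto
  with assms(2) show ?thesis by blast
qed

text \<open>At infinite coupling every bond is opened, so the endpoints of all edges considered so far belong
  to the cluster. When no edge is pending, an edge joining equal spins therefore has both or neither
  of its endpoints in the cluster. The first three premises are the invariant of the growing
  cluster \<open>C\<close> with the set \<open>D\<close> of considered edges.\<close>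

lemma wolff_cluster_infinity:
  assumes "C \<subseteq> {..<N}" "\<And>i. i \<in> C \<Longrightarrow> \<sigma> $ i = s"
    and "\<And>e. e \<in> D \<Longrightarrow> e \<in> C \<and> (e + 1) mod N \<in> C"
    and "J = \<infinity>" "C' \<in> set_pmf (wolff_cluster N J \<sigma> C D)"
  shows "C \<subseteq> C' \<and> C' \<subseteq> {..<N} \<and> (\<forall>i\<in>C'. \<sigma> $ i = s) \<and>
    (\<forall>e<N. \<sigma> $ e = \<sigma> $ ((e + 1) mod N) \<longrightarrow> (e \<in> C' \<longleftrightarrow> (e + 1) mod N \<in> C'))"
  using assms
proof (induction N J \<sigma> C D rule: wolff_cluster.induct)
  case (1 N J \<sigma> C D)
  show ?case
  proof (cases "pending N \<sigma> C D = {}")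
    case True
    then have "C' = C" using "1.prems"(5) by (subst (asm) wolff_cluster.simps) simp
    with True "1.prems"(1-3) show ?thesis by (auto simp: pending_def)
  next
    case False
    define e where "e = Min (pending N \<sigma> C D)"
    have bond: "bernoulli_pmf (bond_prob J) = return_pmf True"
      using "1.prems"(4) by (intro pmf_eqI) (auto simp: bond_prob_def pmf_return indicator_def)
    have C': "C' \<in> set_pmf (wolff_cluster N J \<sigma> (C \<union> {e, (e + 1) mod N}) (insert e D))"
      using "1.prems"(5) False bond
      by (subst (asm) wolff_cluster.simps) (simp add: Let_def bind_return_pmf e_def)
    have "finite (pending N \<sigma> C D)" by (simp add: pending_def)
    then have "e \<in> pending N \<sigma> C D" using False unfolding e_def by (rule Min_in)
    then have e: "e < N" "e \<in> C \<or> (e + 1) mod N \<in> C" "\<sigma> $ e = \<sigma> $ ((e + 1) mod N)"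
      by (auto simp: pending_def)
    have "(if True then C \<union> {e, (e + 1) mod N} else C) \<subseteq> C' \<and>
      C' \<subseteq> {..<N} \<and> (\<forall>i\<in>C'. \<sigma> $ i = s) \<and>
      (\<forall>e<N. \<sigma> $ e = \<sigma> $ ((e + 1) mod N) \<longrightarrow> (e \<in> C' \<longleftrightarrow> (e + 1) mod N \<in> C'))"
      by (rule "1.IH"[OF False e_def, of True]) (use C' e bond "1.prems" in auto)
    then show ?thesis unfolding if_True Un_subset_iff by blast
  qed
qed

text \<open>The flip creates no wall, because no edge joining equal spins leaves the cluster. If there is a
  wall, then the cluster, being of constant spin, is not everything, so some edge leaves it; that
  edge is a wall, and the flip removes it.\<close>

lemma wolff_step_infinity_walls:
  assumes \<sigma>: "\<sigma> \<in> configs N" and "N \<ge> 1" and \<tau>: "\<tau> \<in> set_pmf (wolff_step N \<infinity> \<sigma>)"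
  shows "walls N \<tau> \<subseteq> walls N \<sigma> \<and> (walls N \<sigma> \<noteq> {} \<longrightarrow> walls N \<tau> \<noteq> walls N \<sigma>)"
proof -
  have "{..<N} \<noteq> {}" using \<open>N \<ge> 1\<close> by (auto simp: lessThan_empty_iff)
  then obtain i C where i: "i < N" and C: "C \<in> set_pmf (wolff_cluster N \<infinity> \<sigma> {i} {})"
    and \<tau>_eq: "\<tau> = flip_spins C \<sigma>"
    using \<tau> by (auto simp: wolff_step_def)
  have "{i} \<subseteq> C \<and> C \<subseteq> {..<N} \<and> (\<forall>k\<in>C. \<sigma> $ k = \<sigma> $ i) \<and>
    (\<forall>e<N. \<sigma> $ e = \<sigma> $ ((e + 1) mod N) \<longrightarrow> (e \<in> C \<longleftrightarrow> (e + 1) mod N \<in> C))"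
    using i by (intro wolff_cluster_infinity[OF _ _ _ refl C]) auto
  then have iC: "i \<in> C" and CN: "C \<subseteq> {..<N}" and same: "\<And>k. k \<in> C \<Longrightarrow> \<sigma> $ k = \<sigma> $ i"
    and agree: "\<And>e. e < N \<Longrightarrow> \<sigma> $ e = \<sigma> $ ((e + 1) mod N) \<Longrightarrow> e \<in> C \<longleftrightarrow> (e + 1) mod N \<in> C"
    by blast+
  have dim: "dim_vec \<sigma> = N" using \<sigma> by (auto simp: configs_def)
  have \<tau>_at: "\<tau> $ k = (if k \<in> C then - \<sigma> $ k else \<sigma> $ k)" if "k < N" for k
    using that dim by (simp add: \<tau>_eq flip_spins_def)
  have next_N: "(e + 1) mod N < N" for e using \<open>N \<ge> 1\<close> by simp
  have spin: "\<sigma> $ k = 1 \<or> \<sigma> $ k = -1" if "k < N" for k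
    using \<sigma> that by (auto simp: configs_def)
  have "\<tau> $ e = \<tau> $ ((e + 1) mod N)" if "e < N" "\<sigma> $ e = \<sigma> $ ((e + 1) mod N)" for e
    unfolding \<tau>_at[OF that(1)] \<tau>_at[OF next_N] agree[OF that] that(2) ..
  then have sub: "walls N \<tau> \<subseteq> walls N \<sigma>"
    unfolding walls_def by blast
  moreover have "walls N \<tau> \<noteq> walls N \<sigma>" if ne: "walls N \<sigma> \<noteq> {}"
  proof -
    have "C \<noteq> {..<N}"
    proof
      assume all: "C = {..<N}"
      have "\<sigma> $ e = \<sigma> $ ((e + 1) mod N)" if "e < N" for e
        using same[of e] same[of "(e + 1) mod N"] that next_N all by auto
      then have "walls N \<sigma> = {}" unfolding walls_def by blast
      with ne show False by contradiction
    qed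
    then obtain e where e: "e \<in> C" "(e + 1) mod N \<notin> C"
      using cyclic_shift_closed_eq_all[OF CN] iC by blast
    then have eN: "e < N" using CN by auto
    then have "\<sigma> $ e \<noteq> \<sigma> $ ((e + 1) mod N)" using agree e by blast
    then have "e \<in> walls N \<sigma>" using eN by (simp add: walls_def)
    moreover have "e \<notin> walls N \<tau>"
      using \<tau>_at[OF eN] \<tau>_at[OF next_N[of e]] e spin[OF eN] spin[OF next_N[of e]]
        \<open>\<sigma> $ e \<noteq> \<sigma> $ ((e + 1) mod N)\<close> by (auto simp: walls_def)
    ultimately show ?thesis by blast
  qed
  ultimately show ?thesis by blast
qed

text \<open>There are at most \<open>N\<close> walls initially, and their number strictly decreases until there are none.\<close>

lemma eventually_no_walls:
  assumes "N \<ge> 1" and y: "\<And>k. k \<ge> 1 \<Longrightarrow> y k \<in> configs N"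
    and step: "\<And>k. k \<ge> 1 \<Longrightarrow> y (k + 1) \<in> set_pmf (wolff_step N \<infinity> (y k))"
    and "k > N"
  shows "walls N (y k) = {}"
proof -
  have fin: "finite (walls N \<sigma>)" for \<sigma> by (simp add: walls_def)
  have "card (walls N (y (k + 1))) \<le> N - k" for k
  proof (induction k)
    case 0
    have "walls N (y (0 + 1)) \<subseteq> {..<N}" by (auto simp: walls_def)
    from card_mono[OF _ this] show ?case by simp
  next
    case (Suc k)
    let ?\<sigma> = "y (k + 1)" and ?\<tau> = "y (k + 1 + 1)"
    have w: "walls N ?\<tau> \<subseteq> walls N ?\<sigma> \<and> (walls N ?\<sigma> \<noteq> {} \<longrightarrow> walls N ?\<tau> \<noteq> walls N ?\<sigma>)"
      by (rule wolff_step_infinity_walls[OF y \<open>N \<ge> 1\<close> step]) auto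
    show ?case
    proof (cases "walls N ?\<sigma> = {}")
      case True
      with w show ?thesis by simp
    next
      case False
      with w have "card (walls N ?\<tau>) < card (walls N ?\<sigma>)"
        by (intro psubset_card_mono fin) auto
      with Suc show ?thesis by simp
    qed
  qed
  from this[of "k - 1"] have "card (walls N (y k)) = 0" using \<open>k > N\<close> by simp
  with fin show ?thesis by simp
qed

lemma average_eventually_1:
  fixes a :: "nat \<Rightarrow> real"
  assumes "\<And>k. k > K \<Longrightarrow> a k = 1"
  shows "(\<lambda>M. (\<Sum>k=1..M. a k) / real M) \<longlonglongrightarrow> 1"
proof -
  define c where "c = (\<Sum>k=1..K. a k - 1)"
  \<comment> \<open>After time \<open>K\<close> the sum grows by exactly one per step, so it differs from the number of
    terms by a constant.\<close>
  have sum: "(\<Sum>k=1..K + m. a k) = real (K + m) + c" for m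
  proof (induction m)
    case 0
    then show ?case by (simp add: c_def sum_subtractf)
  next
    case (Suc m)
    then show ?case using assms[of "Suc (K + m)"] by simp
  qed
  have "(\<lambda>M. 1 + c * (1 / real M)) \<longlonglongrightarrow> 1 + c * 0"
    by (intro tendsto_intros lim_1_over_n)
  moreover have "\<forall>\<^sub>F M in sequentially. 1 + c * (1 / real M) = (\<Sum>k=1..M. a k) / real M"
    using eventually_ge_at_top[of "K + 1"]
  proof eventually_elim
    case (elim M)
    then show ?case using sum[of "M - K"] by (simp add: field_simps)
  qed
  ultimately show ?thesis by (auto elim: Lim_transform_eventually)
qed

section \<open>Limits of the eigenvalues\<close>

theorem theorem4p1:
  fixes N :: nat and y1 :: "real vec"
    and P :: "'w measure" and Y :: "nat \<Rightarrow> 'w \<Rightarrow> real vec"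
  assumes "N \<ge> 1" and "y1 \<in> configs N"
  shows
    "(\<forall>x\<in>carrier_vec N. x \<bullet> x \<noteq> 0 \<longrightarrow> integral\<^sup>L (gibbs N 0) (g_fun x) = x \<bullet> x) \<and>
     (wolff_dynamics N 0 y1 P Y \<longrightarrow>
        (AE \<omega> in P. (\<lambda>M. eigval 1 (sample_cov N M (\<lambda>k. Y k \<omega>))) \<longlonglongrightarrow> 1 / real N)) \<and>
     (wolff_dynamics N \<infinity> y1 P Y \<longrightarrow>
        (AE \<omega> in P. (\<lambda>M. eigval 1 (sample_cov N M (\<lambda>k. Y k \<omega>))) \<longlonglongrightarrow> 1) \<and>
        (N \<ge> 2 \<longrightarrow>
           (AE \<omega> in P. (\<lambda>M. eigval 2 (sample_cov N M (\<lambda>k. Y k \<omega>))) \<longlonglongrightarrow> 0)))"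
proof (intro conjI impI ballI)
  fix x :: "real vec" assume "x \<in> carrier_vec N"
  then show "integral\<^sup>L (gibbs N 0) (g_fun x) = x \<bullet> x"
    using assms(2) by (intro gibbs_0_expectation) auto
next
  assume "wolff_dynamics N 0 y1 P Y"
  then interpret finite_markov_chain P "configs N" "wolff_step N 0" Y
    by (rule wolff_dynamics_markov_chain[OF assms(1)])
  have "AE \<omega> in P. (\<lambda>M. (\<Sum>k=1..M. Y k \<omega> $ i * Y k \<omega> $ j) / real M) \<longlonglongrightarrow> 0"
    if "i < N" "j < N" "i \<noteq> j" for i j
    by (rule time_average_eigenfunction[OF spin_product_eigenfunction])
      (use that assms(1) in auto)
  then have "AE \<omega> in P. \<forall>i<N. \<forall>j<N. i \<noteq> j \<longrightarrow>
      (\<lambda>M. (\<Sum>k=1..M. Y k \<omega> $ i * Y k \<omega> $ j) / real M) \<longlonglongrightarrow> 0"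
    by (simp add: AE_all_countable)
  then show "AE \<omega> in P. (\<lambda>M. eigval 1 (sample_cov N M (\<lambda>k. Y k \<omega>))) \<longlonglongrightarrow> 1 / real N"
  proof (rule AE_mp, intro AE_I2 impI)
    fix \<omega> assume "\<omega> \<in> space P" and "\<forall>i<N. \<forall>j<N. i \<noteq> j \<longrightarrow>
      (\<lambda>M. (\<Sum>k=1..M. Y k \<omega> $ i * Y k \<omega> $ j) / real M) \<longlonglongrightarrow> 0"
    then show "(\<lambda>M. eigval 1 (sample_cov N M (\<lambda>k. Y k \<omega>))) \<longlonglongrightarrow> 1 / real N"
      using assms(1) Y_in_states by (intro eigval_1_limit_uncorrelated) auto
  qed
next
  assume "wolff_dynamics N \<infinity> y1 P Y"
  then interpret finite_markov_chain P "configs N" "wolff_step N \<infinity>" Y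
    by (rule wolff_dynamics_markov_chain[OF assms(1)])
  have corr: "(\<lambda>M. (\<Sum>k=1..M. Y k \<omega> $ i * Y k \<omega> $ j) / real M) \<longlonglongrightarrow> 1"
    if \<omega>: "\<omega> \<in> space P" and step: "\<forall>n\<ge>1. Y (n + 1) \<omega> \<in> set_pmf (wolff_step N \<infinity> (Y n \<omega>))"
      and ij: "i < N" "j < N" for \<omega> i j
  proof (rule average_eventually_1)
    fix k assume k: "k > N"
    have "walls N (Y k \<omega>) = {}"
      using step by (intro eventually_no_walls[OF assms(1) Y_in_states[OF _ \<omega>] _ k]) auto
    from no_walls_constant[OF this ij] show "Y k \<omega> $ i * Y k \<omega> $ j = 1"
      using spin_square[OF Y_in_states[OF _ \<omega>] ij(2)] k by simp
  qed
  show "AE \<omega> in P. (\<lambda>M. eigval 1 (sample_cov N M (\<lambda>k. Y k \<omega>))) \<longlonglongrightarrow> 1"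
    using AE_step_possible
  proof (rule AE_mp, intro AE_I2 impI)
    fix \<omega> assume "\<omega> \<in> space P" "\<forall>n\<ge>1. Y (n + 1) \<omega> \<in> set_pmf (wolff_step N \<infinity> (Y n \<omega>))"
    with corr show "(\<lambda>M. eigval 1 (sample_cov N M (\<lambda>k. Y k \<omega>))) \<longlonglongrightarrow> 1"
      using Y_in_states by (intro eigval_limit_fully_correlated(1) assms(1)) blast+
  qed
  show "AE \<omega> in P. (\<lambda>M. eigval 2 (sample_cov N M (\<lambda>k. Y k \<omega>))) \<longlonglongrightarrow> 0" if "N \<ge> 2"
    using AE_step_possible
  proof (rule AE_mp, intro AE_I2 impI)
    fix \<omega> assume "\<omega> \<in> space P" "\<forall>n\<ge>1. Y (n + 1) \<omega> \<in> set_pmf (wolff_step N \<infinity> (Y n \<omega>))"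
    with corr show "(\<lambda>M. eigval 2 (sample_cov N M (\<lambda>k. Y k \<omega>))) \<longlonglongrightarrow> 0"
      using Y_in_states by (intro eigval_limit_fully_correlated(2) assms(1) that) blast+
  qed
qed

end
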